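(* Fix $\alpha\in(0,1)$ and $\beta\in(\tfrac12,1)$, and run the AIR policy with the resolving set $\mathcal T=\mathcal T_L\cup\mathcal T_A$, where $K_L=\lceil \log_{1/\alpha}\log_3 T\rceil$, $K_A=\lceil\log_{1/\beta}\log_3 T\rceil$, $\mathcal T_L=\{\lceil T^{\alpha^k}\rceil: k=1,\dots,K_L\}\cup\{\lceil T/2\rceil\}$ and $\mathcal T_A=\{\lceil T-T^{\beta^k}\rceil: k=1,\dots,K_A\}$. Then the regret of the AIR policy is $\mathcal O(1)$, i.e. there is a constant $C$ independent of $T$ such that $\mathrm{Reg}^{\mathrm{AIR}}(T)\le C$ for all $T$.
   Context: Online linear programming setting: there are $m$ resources and $n$ customer types. Type $j\in[n]=\{1,\dots,n\}$ has reward $r_j\ge 0$ and consumption vector $\boldsymbol A_j\in\mathbb R_+^m$ (the $j$-th column of $\boldsymbol A\in\mathbb R_+^{m\times n}$); $\boldsymbol r=(r_1,\dots,r_n)$. There are $T$ periods and the initial inventory is $T\boldsymbol\rho$ with $\boldsymbol\rho\in\mathbb R_+^m$. In each period $t=1,\dots,T$ one customer arrives whose type $j^t$ is drawn i.i.d. from a probability vector $\boldsymbol p$ with $p_j>0$ for all $j$ and $\sum_jp_j=1$; $\boldsymbol p$ is unknown to the decision maker. After observing $j^t$ the decision maker irrevocably accepts (consuming $\boldsymbol A_{j^t}$, earning $r_{j^t}$) or rejects; total consumption may never exceed $T\boldsymbol\rho$. A policy is non-anticipative if its decision in period $t$ depends only on $j^1,\dots,j^t$. $V^*(T)$ denotes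 the supremum over feasible non-anticipative policies of the expected total reward, $V^\mu(T)$ the expected total reward of policy $\mu$, and $\mathrm{Reg}^\mu(T)=V^*(T)-V^\mu(T)$. For $\boldsymbol b\in\mathbb R_+^m,\boldsymbol d\in\mathbb R_+^n$ let $\phi(\boldsymbol b,\boldsymbol d)=\max\{\boldsymbol r^\top\boldsymbol y:\boldsymbol A\boldsymbol y\le\boldsymbol b,\ \boldsymbol 0\le\boldsymbol y\le\boldsymbol d\}$. $\boldsymbol e_j$ is the $j$-th unit vector. AIR policy with resolving set $\mathcal T\subseteq\{1,\dots,T\}$: maintain $\boldsymbol b^t$ (inventory, $\boldsymbol b^1=T\boldsymbol\rho$), $\boldsymbol N^t$ (counts of arrivals of each type in periods $1,\dots,t-1$, $\boldsymbol N^1=\boldsymbol 0$), and $\boldsymbol u^t,\boldsymbol d^t\in\mathbb R^n$ with $\boldsymbol u^1=\boldsymbol d^1=\boldsymbol 0$. In period $t$: if $t\in\mathcal T$, set $\hat p^t_j=N^t_j/(t-1)$ (with $\hat{\boldsymbol p}^1=\boldsymbol 0$), compute an optimal solution $\boldsymbol y^*$ of $\phi(\boldsymbol b^t,(T-t+1)\hat{\boldsymbol p}^t)$ and reset $\boldsymbol u^t=\boldsymbol y^*$, $\boldsymbol d^t=(T-t+1)\hat{\boldsymbol p}^t$. Then observe $j=j^t$. If $\boldsymbol A_j\le\boldsymbol b^t$, $u^t_j>1$ and $u^t_j\ge d^t_j-u^t_j$, accept and set $\boldsymbol b^{t+1}=\boldsymbol b^t-\boldsymbol A_j$, $\boldsymbol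 u^{t+1}=\boldsymbol u^t-\boldsymbol e_j$; otherwise reject and set $\boldsymbol b^{t+1}=\boldsymbol b^t$, $\boldsymbol u^{t+1}=\boldsymbol u^t$. In both cases $\boldsymbol d^{t+1}=\boldsymbol d^t-\boldsymbol e_j$, $\boldsymbol N^{t+1}=\boldsymbol N^t+\boldsymbol e_j$. Constants in $\mathcal O(\cdot)$ may depend on $m,n,\boldsymbol A,\boldsymbol r,\boldsymbol p,\boldsymbol\rho,\alpha,\beta$ but not on $T$. *)

theory Defs
  imports "HOL-Probability.Probability"
begin

text \<open>
  Resources are indexed by \<open>'m\<close> and customer types by \<open>'n\<close>. Vector inequalities are componentwise.
  An arrival path \<open>\<omega>\<close> gives the type \<open>\<omega> t\<close> of the customer of period \<open>t\<close>; only the periods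
  \<open>1, \<dots>, T\<close> matter. A policy maps a path and a period to the decision to accept.
\<close>

type_synonym 'n policy = "(nat \<Rightarrow> 'n) \<Rightarrow> nat \<Rightarrow> bool"

definition arrivals :: "'n::finite pmf \<Rightarrow> nat \<Rightarrow> (nat \<Rightarrow> 'n) pmf" where
  "arrivals p T = Pi_pmf {1..T} undefined (\<lambda>_. p)"

definition consumption :: "real^'n^'m \<Rightarrow> 'n::finite policy \<Rightarrow> (nat \<Rightarrow> 'n) \<Rightarrow> nat \<Rightarrow> real^'m" where
  "consumption A \<mu> \<omega> t = (\<Sum>s=1..t. if \<mu> \<omega> s then column (\<omega> s) A else 0)"

definition feasible :: "real^'n^'m \<Rightarrow> real^'m \<Rightarrow> nat \<Rightarrow> 'n::finite policy \<Rightarrow> bool" where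
  "feasible A \<rho> T \<mu> \<longleftrightarrow> (\<forall>\<omega>. \<forall>t\<in>{1..T}. consumption A \<mu> \<omega> t \<le> real T *\<^sub>R \<rho>)"

definition non_anticipative :: "nat \<Rightarrow> 'n policy \<Rightarrow> bool" where
  "non_anticipative T \<mu> \<longleftrightarrow>
     (\<forall>t\<in>{1..T}. \<forall>\<omega> \<omega>'. (\<forall>s\<in>{1..t}. \<omega> s = \<omega>' s) \<longrightarrow> \<mu> \<omega> t = \<mu> \<omega>' t)"

definition expected_reward :: "real^'n \<Rightarrow> 'n::finite pmf \<Rightarrow> nat \<Rightarrow> 'n policy \<Rightarrow> real" where
  "expected_reward r p T \<mu> =
     measure_pmf.expectation (arrivals p T) (\<lambda>\<omega>. \<Sum>t=1..T. if \<mu> \<omega> t then r $ \<omega> t else 0)"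

definition optimal_reward ::
  "real^'n^'m \<Rightarrow> real^'n \<Rightarrow> real^'m \<Rightarrow> 'n::finite pmf \<Rightarrow> nat \<Rightarrow> real" where
  "optimal_reward A r \<rho> p T =
     (SUP \<mu> \<in> {\<mu>. feasible A \<rho> T \<mu> \<and> non_anticipative T \<mu>}. expected_reward r p T \<mu>)"

definition regret ::
  "real^'n^'m \<Rightarrow> real^'n \<Rightarrow> real^'m \<Rightarrow> 'n::finite pmf \<Rightarrow> nat \<Rightarrow> 'n policy \<Rightarrow> real" where
  "regret A r \<rho> p T \<mu> = optimal_reward A r \<rho> p T - expected_reward r p T \<mu>"

definition lp_feasible :: "real^'n^'m \<Rightarrow> real^'m \<Rightarrow> real^'n::finite \<Rightarrow> (real^'n) set" where
  "lp_feasible A b d = {y. A *v y \<le> b \<and> 0 \<le> y \<and> y \<le> d}"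

text \<open>
  The linear program need not have a unique optimal solution, so the policy takes as a parameter
  the function that selects one.
\<close>

definition lp_solver ::
  "real^'n^'m \<Rightarrow> real^'n \<Rightarrow> (real^'m \<Rightarrow> real^'n \<Rightarrow> real^'n::finite) \<Rightarrow> bool" where
  "lp_solver A r solve \<longleftrightarrow>
     (\<forall>b\<ge>0. \<forall>d\<ge>0. is_arg_max (\<lambda>y. r \<bullet> y) (\<lambda>y. y \<in> lp_feasible A b d) (solve b d))"

definition arrival_count :: "(nat \<Rightarrow> 'n) \<Rightarrow> nat \<Rightarrow> 'n \<Rightarrow> nat" where
  "arrival_count \<omega> t j = card {s \<in> {1..<t}. \<omega> s = j}"

text \<open>For \<open>t = 1\<close> the quotient is \<open>0 / 0 = 0\<close>.\<close>

definition p_hat :: "(nat \<Rightarrow> 'n) \<Rightarrow> nat \<Rightarrow> real^'n::finite" where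
  "p_hat \<omega> t = (\<chi> j. real (arrival_count \<omega> t j) / real (t - 1))"

record ('m, 'n) air_state =
  inventory :: "real^'m"
  quota :: "real^'n"
  demand :: "real^'n"

definition air_resolve ::
  "(real^'m \<Rightarrow> real^'n \<Rightarrow> real^'n) \<Rightarrow> nat \<Rightarrow> nat set \<Rightarrow> (nat \<Rightarrow> 'n) \<Rightarrow> nat \<Rightarrow>
   ('m::finite, 'n::finite) air_state \<Rightarrow> ('m, 'n) air_state" where
  "air_resolve solve T \<T> \<omega> t \<sigma> =
     (if t \<in> \<T> then
        let d = (real T - real t + 1) *\<^sub>R p_hat \<omega> t
        in \<sigma>\<lparr>quota := solve (inventory \<sigma>) d, demand := d\<rparr>
      else \<sigma>)"

definition air_accepts :: "real^'n^'m \<Rightarrow> ('m::finite, 'n::finite) air_state \<Rightarrow> 'n \<Rightarrow> bool" where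
  "air_accepts A \<sigma> j \<longleftrightarrow>
     column j A \<le> inventory \<sigma> \<and> quota \<sigma> $ j > 1 \<and>
     quota \<sigma> $ j \<ge> demand \<sigma> $ j - quota \<sigma> $ j"

definition air_step ::
  "real^'n^'m \<Rightarrow> 'n \<Rightarrow> ('m::finite, 'n::finite) air_state \<Rightarrow> ('m, 'n) air_state" where
  "air_step A j \<sigma> =
     (if air_accepts A \<sigma> j
      then \<lparr>inventory = inventory \<sigma> - column j A, quota = quota \<sigma> - axis j 1,
            demand = demand \<sigma> - axis j 1\<rparr>
      else \<sigma>\<lparr>demand := demand \<sigma> - axis j 1\<rparr>)"

text \<open>The state at the end of period \<open>t\<close>; at \<open>t = 0\<close> it is the initial state.\<close>

primrec air_after ::
  "real^'n^'m \<Rightarrow> real^'m \<Rightarrow> (real^'m \<Rightarrow> real^'n \<Rightarrow> real^'n) \<Rightarrow> nat \<Rightarrow> nat set \<Rightarrow>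
   (nat \<Rightarrow> 'n) \<Rightarrow> nat \<Rightarrow> ('m::finite, 'n::finite) air_state" where
  "air_after A \<rho> solve T \<T> \<omega> 0 = \<lparr>inventory = real T *\<^sub>R \<rho>, quota = 0, demand = 0\<rparr>"
| "air_after A \<rho> solve T \<T> \<omega> (Suc t) =
     air_step A (\<omega> (Suc t)) (air_resolve solve T \<T> \<omega> (Suc t) (air_after A \<rho> solve T \<T> \<omega> t))"

definition air_policy ::
  "real^'n^'m \<Rightarrow> real^'m \<Rightarrow> (real^'m::finite \<Rightarrow> real^'n \<Rightarrow> real^'n) \<Rightarrow> nat \<Rightarrow> nat set \<Rightarrow>
   'n::finite policy" where
  "air_policy A \<rho> solve T \<T> \<omega> t =
     air_accepts A (air_resolve solve T \<T> \<omega> t (air_after A \<rho> solve T \<T> \<omega> (t - 1))) (\<omega> t)"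

text \<open>
  For \<open>T = 1\<close> the inner logarithm is 0 and the outer one is undefined; the library convention
  \<open>ln 0 = 0\<close> makes \<open>{1..K}\<close> empty, as does reading the outer logarithm as minus infinity.
\<close>

definition resolve_count :: "real \<Rightarrow> nat \<Rightarrow> int" where
  "resolve_count \<gamma> T = \<lceil>log (1 / \<gamma>) (log 3 (real T))\<rceil>"

definition learning_times :: "real \<Rightarrow> nat \<Rightarrow> nat set" where
  "learning_times \<alpha> T =
     {nat \<lceil>real T powr (\<alpha> ^ k)\<rceil> | k. 1 \<le> k \<and> int k \<le> resolve_count \<alpha> T} \<union>
     {nat \<lceil>real T / 2\<rceil>}"

definition allocation_times :: "real \<Rightarrow> nat \<Rightarrow> nat set" where
  "allocation_times \<beta> T =
     {nat \<lceil>real T - real T powr (\<beta> ^ k)\<rceil> | k. 1 \<le> k \<and> int k \<le> resolve_count \<beta> T}"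

end

theory Submission
  imports Defs "HOL-Real_Asymp.Real_Asymp"
begin

text \<open>
  By compensated coupling, the regret is at most the sum over the periods \<open>t\<close> of the expected
  decrease of the hindsight value \<open>\<phi>(b\<^sup>t, D\<^sup>t)\<close>, where \<open>D\<^sup>t\<close> counts the actual arrivals in
  \<open>t, \<dots>, T\<close>, that is not covered by the reward of period \<open>t\<close>. This loss is bounded. Between two
  resolving times the quota stays optimal for the updated inventory and demand, and the difference
  between forecast demand and \<open>D\<^sup>t\<close> stays equal to its value \<open>\<Delta>\<^sub>s\<close> at the last resolving time \<open>s\<close>.
  Optimal solutions are Lipschitz in the demand (Hoffman's bound), so rounding at one half makes
  a decision that is optimal in hindsight unless some \<open>D\<^sup>t\<^sub>j\<close> is smaller than a multiple of \<open>1 + \<bar>\<Delta>\<^sub>s\<bar>\<close>.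
  By Hoeffding's inequality and the spacing of the resolving times, this has probability
  \<open>O(exp (- c t\<^sup>\<alpha>) + exp (- c (T - t + 1)\<^sup>\<gamma>))\<close> with \<open>\<gamma> = 2 - 1 / \<beta> > 0\<close>, which sums to a constant.
\<close>

subsection \<open>Hoffman's error bound\<close>

lemma vec_le_iff: "x \<le> y \<longleftrightarrow> (\<forall>i. x $ i \<le> y $ i)" for x y :: "real^'n"
  by (simp add: less_eq_vec_def)

text \<open>
  A rhs-free form of Hoffman's error bound: put \<open>b\<^sub>c = max (c \<bullet> x1) (c \<bullet> x0 - \<epsilon>)\<close> for the right-hand
  sides. The proof eliminates one coordinate at a time (Fourier--Motzkin).
\<close>

lemma hoffman_supported:
  fixes F :: "(real^'n) set"
  assumes "finite S" "finite F" "\<And>c j. c \<in> F \<Longrightarrow> j \<notin> S \<Longrightarrow> c $ j = 0"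
  shows "\<exists>K\<ge>0. \<forall>x0 x1 \<epsilon>. 0 \<le> \<epsilon> \<longrightarrow>
    (\<exists>x. norm (x - x0) \<le> K * \<epsilon> \<and> (\<forall>c\<in>F. c \<bullet> x \<le> max (c \<bullet> x1) (c \<bullet> x0 - \<epsilon>)))"
  using assms
proof (induction S arbitrary: F rule: finite_induct)
  case empty
  then have "c \<bullet> x = 0" if "c \<in> F" for c x
    using that by (simp add: inner_vec_def)
  then have "\<exists>x. norm (x - x0) \<le> 0 * \<epsilon> \<and> (\<forall>c\<in>F. c \<bullet> x \<le> max (c \<bullet> x1) (c \<bullet> x0 - \<epsilon>))"
    for x0 x1 and \<epsilon> :: real
    by (intro exI[of _ x0]) simp
  then show ?case
    by blast
next
  case (insert n S)
  define P where "P = {c \<in> F. c $ n > 0}"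
  define N where "N = {c \<in> F. c $ n < 0}"
  \<comment> \<open>The scaling gives the two functionals coefficients 1 and -1 at coordinate
    \<open>n\<close>, so their sum no longer involves it.\<close>
  define comb :: "(real^'n) \<times> (real^'n) \<Rightarrow> real^'n"
    where "comb = (\<lambda>(c1, c2). (1 / c1 $ n) *\<^sub>R c1 + (1 / - c2 $ n) *\<^sub>R c2)"
  define F' where "F' = {c \<in> F. c $ n = 0} \<union> comb ` (P \<times> N)"
  have fin: "finite P" "finite N" "finite F'"
    using insert.prems(1) by (auto simp: P_def N_def F'_def)
  have supp: "c $ j = 0" if "c \<in> F'" "j \<notin> S" for c j
    using that insert.prems(2)
    by (cases "j = n") (auto simp: F'_def comb_def P_def N_def)
  obtain K where K: "K \<ge> 0" "\<And>x0 x1 \<epsilon>. 0 \<le> \<epsilon> \<Longrightarrow>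
    \<exists>x. norm (x - x0) \<le> K * \<epsilon> \<and> (\<forall>c\<in>F'. c \<bullet> x \<le> max (c \<bullet> x1) (c \<bullet> x0 - \<epsilon>))"
    using insert.IH[OF fin(3) supp] by blast
  \<comment> \<open>In \<open>comb (c1, c2)\<close> two tolerances of \<epsilon> add up to at most
    \<open>M * \<epsilon>\<close>, so the induction hypothesis is used at
    \<open>M * \<epsilon>\<close>. Functionals with \<open>c $ n = 0\<close> contribute
    \<open>2 / 0 = 0\<close>.\<close>
  define M where "M = 1 + (\<Sum>c\<in>F. 2 / \<bar>c $ n\<bar>)"
  define B where "B = (\<Sum>c\<in>F. norm c)"
  have M1: "1 \<le> M"
    unfolding M_def by (simp add: sum_nonneg)
  have MB: "1 / \<bar>c $ n\<bar> \<le> M / 2" "norm c \<le> B" if "c \<in> F" for c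
  proof -
    have "2 / \<bar>c $ n\<bar> \<le> (\<Sum>c\<in>F. 2 / \<bar>c $ n\<bar>)"
      by (rule member_le_sum) (use that insert.prems(1) in auto)
    then show "1 / \<bar>c $ n\<bar> \<le> M / 2"
      by (simp add: M_def)
    show "norm c \<le> B"
      unfolding B_def by (rule member_le_sum) (use that insert.prems(1) in auto)
  qed
  have B0: "B \<ge> 0"
    unfolding B_def by (simp add: sum_nonneg)
  \<comment> \<open>The point \<open>x'\<close> lies within \<open>K * M * \<epsilon>\<close> of
    \<open>x0\<close>, so it violates a constraint of \<open>F\<close> by at most
    \<open>(1 + B * (K * M)) * \<epsilon>\<close>. Dividing by \<open>\<bar>c $ n\<bar>\<close>
    shows that a shift of size at most \<open>W * \<epsilon>\<close> along \<open>n\<close> repairs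
    it.\<close>
  define W where "W = (1 + B * (K * M)) * M"
  have W0: "W \<ge> 0"
    using M1 B0 K(1) by (simp add: W_def)
  show ?case
  proof (intro exI[of _ "K * M + W"] conjI allI impI)
    show "0 \<le> K * M + W"
      using K(1) M1 W0 by simp
  next
    fix x0 x1 :: "real^'n" and \<epsilon> :: real
    assume \<epsilon>: "0 \<le> \<epsilon>"
    define b where "b c = max (c \<bullet> x1) (c \<bullet> x0 - \<epsilon>)" for c
    obtain x' where x': "norm (x' - x0) \<le> K * (M * \<epsilon>)"
      "\<And>c. c \<in> F' \<Longrightarrow> c \<bullet> x' \<le> max (c \<bullet> x1) (c \<bullet> x0 - M * \<epsilon>)"
      using K(2)[of "M * \<epsilon>" x0 x1] \<epsilon> M1 by auto
    have M\<epsilon>: "\<epsilon> \<le> M * \<epsilon>"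
      using M1 \<epsilon> mult_right_mono[of 1 M \<epsilon>] by simp
    \<comment> \<open>The shift along \<open>n\<close> that makes constraint \<open>c\<close> tight:
      an upper limit for \<open>c\<close> in \<open>P\<close>, a lower limit for \<open>c\<close> in
      \<open>N\<close>.\<close>
    define slack where "slack c = (b c - c \<bullet> x') / c $ n" for c
    \<comment> \<open>The largest lower limit; the inserted element keeps the set nonempty when
      \<open>N\<close> is empty and bounds \<open>w\<close> from below.\<close>
    define w where "w = Max (insert (- (W * \<epsilon>)) (slack ` N))"
    have slack_bound: "b c - c \<bullet> x' \<ge> - ((1 + B * (K * M)) * \<epsilon>)" if "c \<in> F" for c
    proof -
      have "c \<bullet> x' - c \<bullet> x0 = c \<bullet> (x' - x0)"
        by (simp add: inner_diff_right)
      also have "\<dots> \<le> norm c * norm (x' - x0)"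
        by (rule norm_cauchy_schwarz)
      also have "\<dots> \<le> B * (K * (M * \<epsilon>))"
        using MB(2)[OF that] x'(1) B0 by (intro mult_mono) auto
      finally show ?thesis
        unfolding b_def by (simp add: algebra_simps)
    qed
    have W_ge: "(1 + B * (K * M)) * \<epsilon> / \<bar>c $ n\<bar> \<le> W * \<epsilon>" if "c \<in> F" for c
    proof -
      have "(1 + B * (K * M)) * \<epsilon> / \<bar>c $ n\<bar> = (1 + B * (K * M)) * \<epsilon> * (1 / \<bar>c $ n\<bar>)"
        by simp
      also have "\<dots> \<le> (1 + B * (K * M)) * \<epsilon> * M"
        using MB(1)[OF that] M1 B0 K(1) \<epsilon> by (intro mult_left_mono) auto
      also have "\<dots> = W * \<epsilon>"
        by (simp add: W_def mult_ac)
      finally show ?thesis .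
    qed
    have low: "slack c \<le> W * \<epsilon>" if "c \<in> N" for c
    proof -
      have c: "c \<in> F" "c $ n < 0"
        using that by (auto simp: N_def)
      have "slack c = - (b c - c \<bullet> x') / \<bar>c $ n\<bar>"
        using c by (simp add: slack_def field_simps)
      also have "\<dots> \<le> (1 + B * (K * M)) * \<epsilon> / \<bar>c $ n\<bar>"
        using slack_bound[OF c(1)] by (intro divide_right_mono) auto
      finally show ?thesis
        using W_ge[OF c(1)] by simp
    qed
    have up: "- (W * \<epsilon>) \<le> slack c" if "c \<in> P" for c
    proof -
      have c: "c \<in> F" "c $ n > 0"
        using that by (auto simp: P_def)
      have "- ((1 + B * (K * M)) * \<epsilon>) / \<bar>c $ n\<bar> \<le> (b c - c \<bullet> x') / \<bar>c $ n\<bar>"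
        using slack_bound[OF c(1)] by (intro divide_right_mono) auto
      also have "\<dots> = slack c"
        using c by (simp add: slack_def)
      finally show ?thesis
        using W_ge[OF c(1)] by simp
    qed
    \<comment> \<open>This is the content of the eliminated constraint \<open>comb (c1, c2)\<close>
      at \<open>x'\<close>: no lower limit exceeds an upper one, so one shift serves all
      constraints.\<close>
    have cross: "slack c2 \<le> slack c1" if "c1 \<in> P" "c2 \<in> N" for c1 c2
    proof -
      define a1 a2 where "a1 = c1 $ n" and "a2 = - c2 $ n"
      have a: "a1 > 0" "a2 > 0" and cF: "c1 \<in> F" "c2 \<in> F"
        using that by (auto simp: P_def N_def a1_def a2_def)
      have comb_inner: "comb (c1, c2) \<bullet> x = c1 \<bullet> x / a1 + c2 \<bullet> x / a2" for x
        by (simp add: comb_def inner_add_left inner_diff_left a1_def a2_def)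
      have "1 / a1 + 1 / a2 \<le> M"
        using MB(1)[OF cF(1)] MB(1)[OF cF(2)] a by (simp add: a1_def a2_def)
      then have "(1 / a1 + 1 / a2) * \<epsilon> \<le> M * \<epsilon>"
        using \<epsilon> by (rule mult_right_mono)
      then have M2: "\<epsilon> / a1 + \<epsilon> / a2 \<le> M * \<epsilon>"
        by (simp add: algebra_simps)
      have b1: "c \<bullet> x1 / a \<le> b c / a" "c \<bullet> x0 / a - \<epsilon> / a \<le> b c / a" if "a > 0" for c a
        using that by (auto simp: b_def divide_right_mono diff_divide_distrib[symmetric])
      have "comb (c1, c2) \<in> F'"
        using that by (auto simp: F'_def)
      from x'(2)[OF this] have "comb (c1, c2) \<bullet> x' \<le> b c1 / a1 + b c2 / a2"
        unfolding comb_inner using b1[OF a(1), of c1] b1[OF a(2), of c2] M2 by linarith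
      then show ?thesis
        unfolding comb_inner
        using that a by (simp add: slack_def a1_def a2_def diff_divide_distrib)
    qed
    have w_low: "- (W * \<epsilon>) \<le> w" "\<And>c. c \<in> N \<Longrightarrow> slack c \<le> w"
      using fin(2) by (auto simp: w_def intro: Max_ge)
    have w_up: "w \<le> W * \<epsilon>"
      unfolding w_def using fin(2) low W0 \<epsilon> by (subst Max_le_iff) auto
    have w_up': "w \<le> slack c" if "c \<in> P" for c
      unfolding w_def using fin(2) up[OF that] cross[OF that] by (subst Max_le_iff) auto
    define x where "x = x' + axis n w"
    have inner_x: "c \<bullet> x = c \<bullet> x' + c $ n * w" for c
      by (simp add: x_def inner_add_right inner_axis)
    show "\<exists>x. norm (x - x0) \<le> (K * M + W) * \<epsilon> \<and> (\<forall>c\<in>F. c \<bullet> x \<le> max (c \<bullet> x1) (c \<bullet> x0 - \<epsilon>))"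
    proof (intro exI[of _ x] conjI ballI)
      have "norm (x - x0) \<le> norm (x' - x0) + norm (axis n w :: real^'n)"
        unfolding x_def by (metis add_diff_eq add.commute norm_triangle_ineq)
      also have "norm (axis n w :: real^'n) = \<bar>w\<bar>"
      proof -
        have "(axis n w :: real^'n) = w *\<^sub>R axis n 1"
          by (simp add: vec_eq_iff axis_def)
        then show ?thesis
          by (simp add: norm_axis_1)
      qed
      finally show "norm (x - x0) \<le> (K * M + W) * \<epsilon>"
        using x'(1) w_low(1) w_up by (simp add: algebra_simps abs_le_iff)
    next
      fix c assume c: "c \<in> F"
      consider "c $ n = 0" | "c \<in> P" | "c \<in> N"
        using c by (force simp: P_def N_def)
      then have "c \<bullet> x \<le> b c"
      proof cases
        case 1
        then have "c \<in> F'"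
          using c by (simp add: F'_def)
        from x'(2)[OF this] show ?thesis
          using 1 M\<epsilon> by (simp add: inner_x b_def)
      next
        case 2
        with w_up'[OF 2] show ?thesis
          by (simp add: inner_x slack_def P_def field_simps)
      next
        case 3
        with w_low(2)[OF 3] show ?thesis
          by (simp add: inner_x slack_def N_def field_simps)
      qed
      then show "c \<bullet> x \<le> max (c \<bullet> x1) (c \<bullet> x0 - \<epsilon>)"
        by (simp add: b_def)
    qed
  qed
qed

lemma hoffman:
  fixes F :: "(real^'n) set"
  assumes "finite F"
  obtains K where "K \<ge> 0" "\<And>x0 x1 \<epsilon>. 0 \<le> \<epsilon> \<Longrightarrow>
    \<exists>x. norm (x - x0) \<le> K * \<epsilon> \<and> (\<forall>c\<in>F. c \<bullet> x \<le> max (c \<bullet> x1) (c \<bullet> x0 - \<epsilon>))"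
  using hoffman_supported[OF finite_class.finite_UNIV assms] by auto

subsection \<open>Sensitivity of the linear program\<close>

definition lp_optimal :: "real^'n^'m \<Rightarrow> real^'n \<Rightarrow> real^'m \<Rightarrow> real^'n \<Rightarrow> real^'n::finite \<Rightarrow> bool" where
  "lp_optimal A r b d y \<longleftrightarrow> y \<in> lp_feasible A b d \<and> (\<forall>z\<in>lp_feasible A b d. r \<bullet> z \<le> r \<bullet> y)"

lemma lp_feasible_iff:
  "y \<in> lp_feasible A b d \<longleftrightarrow> (\<forall>i. row i A \<bullet> y \<le> b $ i) \<and> (\<forall>j. 0 \<le> y $ j \<and> y $ j \<le> d $ j)"
  by (auto simp: lp_feasible_def vec_le_iff matrix_vector_mult_def inner_vec_def row_def)

lemma lp_solver_optimal:
  assumes "lp_solver A r solve" "0 \<le> b" "0 \<le> d"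
  shows "lp_optimal A r b d (solve b d)"
  using assms by (auto simp: lp_solver_def lp_optimal_def is_arg_max_linorder)

lemma row_inner: "row i A \<bullet> y = (\<Sum>j\<in>UNIV. A $ i $ j * y $ j)" for A :: "real^'n^'m"
  by (simp add: inner_vec_def row_def)

lemma row_inner_mono:
  fixes A :: "real^'n^'m"
  assumes "\<And>i j. 0 \<le> A $ i $ j" "\<And>j. y $ j \<le> z $ j"
  shows "row i A \<bullet> y \<le> row i A \<bullet> z"
  unfolding row_inner by (intro sum_mono mult_left_mono assms)

text \<open>
  Lowering every coordinate by \<open>K \<delta>\<close>, truncated at \<open>0\<close>, either frees \<open>\<delta>\<close> units of a resource
  or stops its consumption altogether.
\<close>

lemma lp_value_lipschitz:
  fixes A :: "real^'n^'m" and r :: "real^'n"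
  assumes A: "\<And>i j. 0 \<le> A $ i $ j" and r: "\<And>j. 0 \<le> r $ j"
  obtains L where "L \<ge> 0"
    "\<And>b b' d d' \<delta> y. 0 \<le> b' \<Longrightarrow> 0 \<le> d' \<Longrightarrow> 0 \<le> \<delta> \<Longrightarrow> (\<And>i. b $ i - b' $ i \<le> \<delta>) \<Longrightarrow>
      (\<And>j. d $ j - d' $ j \<le> \<delta>) \<Longrightarrow> y \<in> lp_feasible A b d \<Longrightarrow>
      \<exists>y'\<in>lp_feasible A b' d'. r \<bullet> y - L * \<delta> \<le> r \<bullet> y'"
proof -
  \<comment> \<open>Since \<open>1 / 0 = 0\<close>, the sum dominates the reciprocal of every
    positive entry, so \<open>K * A $ i $ j\<close> is at least 1 there. The summand 1 makes
    \<open>K * \<delta>\<close> cover the loss of demand.\<close>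
  define K where "K = 1 + (\<Sum>i\<in>UNIV. \<Sum>j\<in>UNIV. 1 / A $ i $ j)"
  have K1: "1 \<le> K"
    unfolding K_def using A by (simp add: sum_nonneg)
  have KA: "1 \<le> K * A $ i $ j" if "A $ i $ j > 0" for i j
  proof -
    have "1 / A $ i $ j \<le> (\<Sum>j\<in>UNIV. 1 / A $ i $ j)"
      by (rule member_le_sum) (use A in auto)
    also have "\<dots> \<le> (\<Sum>i\<in>UNIV. \<Sum>j\<in>UNIV. 1 / A $ i $ j)"
      by (rule member_le_sum[where f = "\<lambda>i. \<Sum>j\<in>UNIV. 1 / A $ i $ j"])
        (use A in \<open>auto intro!: sum_nonneg\<close>)
    finally have "1 / A $ i $ j \<le> K"
      by (simp add: K_def)
    then show ?thesis
      using that by (simp add: field_simps)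
  qed
  show ?thesis
  proof (rule that[of "(\<Sum>j\<in>UNIV. r $ j) * K"])
    show "0 \<le> (\<Sum>j\<in>UNIV. r $ j) * K"
      using r K1 by (simp add: sum_nonneg)
  next
    fix b b' :: "real^'m" and d d' y :: "real^'n" and \<delta> :: real
    assume b': "0 \<le> b'" and d': "0 \<le> d'" and \<delta>: "0 \<le> \<delta>" and b: "\<And>i. b $ i - b' $ i \<le> \<delta>"
      and d: "\<And>j. d $ j - d' $ j \<le> \<delta>" and y: "y \<in> lp_feasible A b d"
    define y' where "y' = (\<chi> j. max 0 (y $ j - K * \<delta>))"
    have \<delta>K: "\<delta> \<le> K * \<delta>"
      using K1 \<delta> mult_right_mono[of 1 K \<delta>] by simp
    have y'y: "y' $ j \<le> y $ j" for j
      using y K1 \<delta> by (auto simp: y'_def lp_feasible_iff)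
    have "row i A \<bullet> y' \<le> b' $ i" for i
    proof (cases "\<exists>k. A $ i $ k > 0 \<and> K * \<delta> \<le> y $ k")
      case True
      then obtain k where k: "A $ i $ k > 0" "K * \<delta> \<le> y $ k"
        by blast
      have "row i A \<bullet> y' \<le> row i A \<bullet> (y - axis k (K * \<delta>))"
        using A y'y k by (intro row_inner_mono) (auto simp: y'_def axis_def)
      also have "\<dots> = row i A \<bullet> y - (K * A $ i $ k) * \<delta>"
        by (simp add: inner_diff_right inner_axis row_def)
      also have "\<dots> \<le> row i A \<bullet> y - \<delta>"
        using mult_right_mono[OF KA[OF k(1)] \<delta>] by simp
      also have "\<dots> \<le> b' $ i"
        using y b[of i] by (simp add: lp_feasible_iff) (smt (verit))
      finally show ?thesis .
    next
      case False
      then have "A $ i $ k * y' $ k = 0" for k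
        using A[of i k] by (cases "A $ i $ k = 0") (auto simp: y'_def not_le)
      then show ?thesis
        using b' unfolding row_inner vec_le_iff by (subst sum.neutral) auto
    qed
    moreover have "0 \<le> y' $ j" "y' $ j \<le> d' $ j" for j
    proof -
      have "y $ j \<le> d $ j"
        using y by (simp add: lp_feasible_iff)
      then show "0 \<le> y' $ j" "y' $ j \<le> d' $ j"
        using d' d[of j] \<delta>K by (auto simp: y'_def vec_le_iff)
    qed
    ultimately have "y' \<in> lp_feasible A b' d'"
      by (simp add: lp_feasible_iff)
    moreover have "r \<bullet> y - (\<Sum>j\<in>UNIV. r $ j) * K * \<delta> \<le> r \<bullet> y'"
    proof -
      have "r $ j * y $ j - r $ j * (K * \<delta>) \<le> r $ j * y' $ j" for j
        using r[of j] by (auto simp: y'_def right_diff_distrib[symmetric] intro!: mult_left_mono)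
      then have "(\<Sum>j\<in>UNIV. r $ j * y $ j - r $ j * (K * \<delta>)) \<le> (\<Sum>j\<in>UNIV. r $ j * y' $ j)"
        by (rule sum_mono)
      then show ?thesis
        by (simp add: inner_vec_def sum_subtractf sum_distrib_right mult.assoc)
    qed
    ultimately show "\<exists>y'\<in>lp_feasible A b' d'. r \<bullet> y - (\<Sum>j\<in>UNIV. r $ j) * K * \<delta> \<le> r \<bullet> y'"
      by blast
  qed
qed

text \<open>The optimal solutions for \<open>d'\<close> form a polyhedron: the feasibility
  constraints together with \<open>r \<bullet> z \<ge> r \<bullet> y\<close>. By the Lipschitz bound
  on the value, \<open>u\<close> violates each of these by at most
  \<open>(1 + L) * \<delta>\<close>, and Hoffman's bound moves \<open>u\<close> into the polyhedron
  at proportional cost.\<close>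

lemma lp_optimal_stability:
  fixes A :: "real^'n^'m" and r :: "real^'n"
  assumes A: "\<And>i j. 0 \<le> A $ i $ j" and r: "\<And>j. 0 \<le> r $ j"
  obtains \<kappa> where "\<kappa> \<ge> 0"
    "\<And>b d d' \<delta> u y. 0 \<le> b \<Longrightarrow> 0 \<le> d \<Longrightarrow> (\<And>j. \<bar>d $ j - d' $ j\<bar> \<le> \<delta>) \<Longrightarrow>
      lp_optimal A r b d u \<Longrightarrow> lp_optimal A r b d' y \<Longrightarrow>
      \<exists>z. lp_optimal A r b d' z \<and> (\<forall>j. \<bar>z $ j - u $ j\<bar> \<le> \<kappa> * \<delta>)"
proof -
  obtain L where L: "L \<ge> 0"
    "\<And>b b' d d' \<delta> y. 0 \<le> b' \<Longrightarrow> 0 \<le> d' \<Longrightarrow> 0 \<le> \<delta> \<Longrightarrow> (\<And>i. b $ i - b' $ i \<le> \<delta>) \<Longrightarrow>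
      (\<And>j. d $ j - d' $ j \<le> \<delta>) \<Longrightarrow> y \<in> lp_feasible A b d \<Longrightarrow>
      \<exists>y'\<in>lp_feasible A b' d'. r \<bullet> y - L * \<delta> \<le> r \<bullet> y'"
    using lp_value_lipschitz[of A r] A r by blast
  define F where "F = range (\<lambda>i. row i A) \<union> range (\<lambda>j. - axis j 1) \<union> range (\<lambda>j. axis j 1) \<union> {- r}"
  have "finite F"
    by (simp add: F_def)
  then obtain K where K: "K \<ge> 0" "\<And>x0 x1 \<epsilon>. 0 \<le> \<epsilon> \<Longrightarrow>
    \<exists>x. norm (x - x0) \<le> K * \<epsilon> \<and> (\<forall>c\<in>F. c \<bullet> x \<le> max (c \<bullet> x1) (c \<bullet> x0 - \<epsilon>))"
    using hoffman by blast
  show ?thesis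
  proof (rule that[of "K * (1 + L)"])
    show "0 \<le> K * (1 + L)"
      using K(1) L(1) by simp
  next
    fix b :: "real^'m" and d d' u y :: "real^'n" and \<delta> :: real
    assume b: "0 \<le> b" and d: "0 \<le> d" and dd': "\<And>j. \<bar>d $ j - d' $ j\<bar> \<le> \<delta>"
      and u: "lp_optimal A r b d u" and y: "lp_optimal A r b d' y"
    have \<delta>: "0 \<le> \<delta>"
      using dd' abs_ge_zero order_trans by blast
    have "d' $ j - d $ j \<le> \<delta>" for j
      using dd'[of j] by simp
    with L(2)[of b d \<delta> b d' y] obtain y' where "y' \<in> lp_feasible A b d" "r \<bullet> y - L * \<delta> \<le> r \<bullet> y'"
      using b d \<delta> y by (auto simp: lp_optimal_def)
    then have ru: "r \<bullet> y - L * \<delta> \<le> r \<bullet> u"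
      using u by (force simp: lp_optimal_def)
    define \<epsilon> where "\<epsilon> = (1 + L) * \<delta>"
    have \<epsilon>: "0 \<le> \<epsilon>" "L * \<delta> \<le> \<epsilon>" "\<delta> \<le> \<epsilon>"
      using L(1) \<delta> by (auto simp: \<epsilon>_def algebra_simps)
    \<comment> \<open>Each right-hand side of the polyhedron is at least both
      \<open>c \<bullet> y\<close>, as \<open>y\<close> lies in it, and
      \<open>c \<bullet> u - \<epsilon>\<close>, as \<open>u\<close> nearly does; hence it bounds
      the maximum.\<close>
    obtain z where z: "norm (z - u) \<le> K * \<epsilon>" "\<And>c. c \<in> F \<Longrightarrow> c \<bullet> z \<le> max (c \<bullet> y) (c \<bullet> u - \<epsilon>)"
      using K(2)[OF \<epsilon>(1), of u y] by blast
    have "row i A \<bullet> z \<le> b $ i" for i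
      using z(2)[of "row i A"] u y \<epsilon>(1)
      by (simp add: F_def lp_optimal_def lp_feasible_iff le_max_iff_disj) (smt (verit))
    moreover have "0 \<le> z $ j" for j
      using z(2)[of "- axis j 1"] u y \<epsilon>(1)
      by (simp add: F_def lp_optimal_def lp_feasible_iff le_max_iff_disj inner_axis') (smt (verit))
    moreover have "z $ j \<le> d' $ j" for j
      using z(2)[of "axis j 1"] u y \<epsilon>(3) dd'[of j]
      by (simp add: F_def lp_optimal_def lp_feasible_iff le_max_iff_disj inner_axis') (smt (verit))
    moreover have "r \<bullet> y \<le> r \<bullet> z"
      using z(2)[of "- r"] ru \<epsilon>(2) by (auto simp: F_def)
    ultimately have "lp_optimal A r b d' z"
      using y by (force simp: lp_optimal_def lp_feasible_iff)
    moreover have "\<bar>z $ j - u $ j\<bar> \<le> K * (1 + L) * \<delta>" for j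
      using component_le_norm_cart[of "z - u" j] z(1) by (simp add: \<epsilon>_def mult.assoc)
    ultimately show "\<exists>z. lp_optimal A r b d' z \<and> (\<forall>j. \<bar>z $ j - u $ j\<bar> \<le> K * (1 + L) * \<delta>)"
      by blast
  qed
qed

subsection \<open>Loss of the policy on a sample path\<close>

definition window_count :: "(nat \<Rightarrow> 'n) \<Rightarrow> nat set \<Rightarrow> 'n \<Rightarrow> real" where
  "window_count \<omega> S j = real (card {s \<in> S. \<omega> s = j})"

definition remaining :: "nat \<Rightarrow> (nat \<Rightarrow> 'n::finite) \<Rightarrow> nat \<Rightarrow> real^'n" where
  "remaining T \<omega> t = (\<chi> j. window_count \<omega> {t..T} j)"

lemma remaining_Suc:
  assumes "t \<le> T"
  shows "remaining T \<omega> (Suc t) = remaining T \<omega> t - axis (\<omega> t) 1"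
proof -
  have "{s \<in> {t..T}. \<omega> s = j} =
      (if \<omega> t = j then insert t {s \<in> {Suc t..T}. \<omega> s = j} else {s \<in> {Suc t..T}. \<omega> s = j})" for j
    using assms by (auto simp: not_less_eq_eq) (metis le_antisym not_less_eq_eq)+
  then show ?thesis
    by (auto simp: remaining_def window_count_def vec_eq_iff axis_def)
qed

lemma remaining_nonneg: "0 \<le> remaining T \<omega> t"
  by (simp add: remaining_def window_count_def vec_le_iff)

lemma remaining_antimono: "s \<le> t \<Longrightarrow> remaining T \<omega> t $ j \<le> remaining T \<omega> s $ j"
  by (auto simp: remaining_def window_count_def intro!: card_mono)

lemma remaining_beyond: "T < t \<Longrightarrow> remaining T \<omega> t = 0"
  by (simp add: remaining_def window_count_def vec_eq_iff)

text \<open>With demand above 2, a quota of at least half the demand exceeds 1. The quota consumes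
  no more than the inventory, so the inventory covers one unit of type \<open>j\<close>. Only the
  rounding test remains.\<close>

lemma air_accepts_iff:
  assumes A: "\<And>i j. 0 \<le> A $ i $ j" and feas: "quota \<sigma> \<in> lp_feasible A (inventory \<sigma>) (demand \<sigma>)"
    and d: "2 < demand \<sigma> $ j"
  shows "air_accepts A \<sigma> j \<longleftrightarrow> demand \<sigma> $ j \<le> 2 * quota \<sigma> $ j"
proof
  assume "demand \<sigma> $ j \<le> 2 * quota \<sigma> $ j"
  then have q: "1 < quota \<sigma> $ j"
    using d by simp
  have "A $ i $ j \<le> inventory \<sigma> $ i" for i
  proof -
    have "A $ i $ j * 1 \<le> A $ i $ j * quota \<sigma> $ j"
      using q A by (intro mult_left_mono) auto
    also have "\<dots> \<le> row i A \<bullet> quota \<sigma>"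
      unfolding row_inner by (rule member_le_sum[where f = "\<lambda>j. A $ i $ j * quota \<sigma> $ j"])
        (use A feas in \<open>auto simp: lp_feasible_iff\<close>)
    also have "\<dots> \<le> inventory \<sigma> $ i"
      using feas by (simp add: lp_feasible_iff)
    finally show ?thesis
      by simp
  qed
  then show "air_accepts A \<sigma> j"
    using q \<open>demand \<sigma> $ j \<le> _\<close> by (simp add: air_accepts_def vec_le_iff column_def)
qed (simp add: air_accepts_def)

lemma row_inner_axis: "row i A \<bullet> axis j 1 = A $ i $ j" for A :: "real^'n^'m"
  by (simp add: inner_axis row_def)

lemma lp_feasible_minus_axis:
  assumes "y \<in> lp_feasible A b d" "1 \<le> y $ j"
  shows "y - axis j 1 \<in> lp_feasible A (b - column j A) (d - axis j 1)"
  using assms unfolding lp_feasible_iff inner_diff_right row_inner_axis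
  by (auto simp: column_def axis_def)

lemma lp_feasible_plus_axis:
  assumes "y \<in> lp_feasible A (b - column j A) (d - axis j 1)"
  shows "y + axis j 1 \<in> lp_feasible A b d"
  using assms unfolding lp_feasible_iff inner_add_right row_inner_axis
  by (auto simp: column_def axis_def le_diff_eq)

lemma lp_feasible_reject:
  assumes "y \<in> lp_feasible A b d" "y $ j \<le> d $ j - 1"
  shows "y \<in> lp_feasible A b (d - axis j 1)"
  using assms by (auto simp: lp_feasible_iff axis_def)

lemma lp_feasible_mono_demand:
  assumes "y \<in> lp_feasible A b (d - axis j 1)"
  shows "y \<in> lp_feasible A b d"
  using assms by (auto simp: lp_feasible_iff axis_def) (smt (verit))

lemma air_step_optimal:
  assumes A: "\<And>i j. 0 \<le> A $ i $ j" and opt: "lp_optimal A r (inventory \<sigma>) (demand \<sigma>) (quota \<sigma>)"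
    and d: "2 < demand \<sigma> $ j" and \<sigma>': "\<sigma>' = air_step A j \<sigma>"
  shows "lp_optimal A r (inventory \<sigma>') (demand \<sigma>') (quota \<sigma>')"
proof -
  have feas: "quota \<sigma> \<in> lp_feasible A (inventory \<sigma>) (demand \<sigma>)"
    using opt by (simp add: lp_optimal_def)
  note acc = air_accepts_iff[OF A feas d]
  show ?thesis
  proof (cases "air_accepts A \<sigma> j")
    case True
    then have "1 \<le> quota \<sigma> $ j"
      by (simp add: air_accepts_def)
    have "r \<bullet> z \<le> r \<bullet> (quota \<sigma> - axis j 1)"
      if "z \<in> lp_feasible A (inventory \<sigma> - column j A) (demand \<sigma> - axis j 1)" for z
      using opt lp_feasible_plus_axis[OF that]
      by (force simp: lp_optimal_def inner_add_right inner_diff_right)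
    with lp_feasible_minus_axis[OF feas \<open>1 \<le> quota \<sigma> $ j\<close>] show ?thesis
      using True by (simp add: \<sigma>' air_step_def lp_optimal_def)
  next
    case False
    then have "quota \<sigma> $ j \<le> demand \<sigma> $ j - 1"
      using acc d by simp
    from lp_feasible_reject[OF feas this] show ?thesis
      using False opt lp_feasible_mono_demand
      by (force simp: \<sigma>' air_step_def lp_optimal_def)
  qed
qed

lemma demand_air_step: "demand (air_step A j \<sigma>) = demand \<sigma> - axis j 1"
  by (simp add: air_step_def)

text \<open>
  If the quota is optimal for a demand within \<open>\<delta>\<close> of the true remaining demand \<open>D\<close>, then stability
  yields a hindsight optimal solution that takes the same decision as the policy.
\<close>

lemma air_step_no_loss:
  assumes A: "\<And>i j. 0 \<le> A $ i $ j"
    and stab: "\<And>b d d' \<delta> u y. 0 \<le> b \<Longrightarrow> 0 \<le> d \<Longrightarrow> (\<And>j. \<bar>d $ j - d' $ j\<bar> \<le> \<delta>) \<Longrightarrow>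
      lp_optimal A r b d u \<Longrightarrow> lp_optimal A r b d' y \<Longrightarrow>
      \<exists>z. lp_optimal A r b d' z \<and> (\<forall>j. \<bar>z $ j - u $ j\<bar> \<le> \<kappa> * \<delta>)"
    and inv: "0 \<le> inventory \<sigma>"
    and opt: "lp_optimal A r (inventory \<sigma>) (demand \<sigma>) (quota \<sigma>)"
    and y: "lp_optimal A r (inventory \<sigma>) D y"
    and close: "\<And>j. \<bar>demand \<sigma> $ j - D $ j\<bar> \<le> \<delta>"
    and d: "2 < demand \<sigma> $ j" "2 + 2 * (\<kappa> + 1) * \<delta> \<le> demand \<sigma> $ j"
  shows "\<exists>z\<in>lp_feasible A (inventory (air_step A j \<sigma>)) (D - axis j 1).
    r \<bullet> y \<le> r \<bullet> z + (if air_accepts A \<sigma> j then r $ j else 0)"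
proof -
  have feas: "quota \<sigma> \<in> lp_feasible A (inventory \<sigma>) (demand \<sigma>)"
    using opt by (simp add: lp_optimal_def)
  have "0 \<le> demand \<sigma>"
    using feas unfolding lp_feasible_iff vec_le_iff by (metis order_trans zero_index)
  from stab[OF inv this close opt y] obtain z
    where z: "lp_optimal A r (inventory \<sigma>) D z" "\<And>j. \<bar>z $ j - quota \<sigma> $ j\<bar> \<le> \<kappa> * \<delta>"
    by blast
  have zy: "r \<bullet> z = r \<bullet> y" and z_feas: "z \<in> lp_feasible A (inventory \<sigma>) D"
    using z(1) y by (auto simp: lp_optimal_def intro: antisym)
  \<comment> \<open>Half of this margin is \<open>1 + \<kappa> * \<delta> + \<delta>\<close>: one
    unit for the customer, \<open>\<kappa> * \<delta>\<close> for passing from the quota to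
    \<open>z\<close>, and \<delta> for passing from the forecast demand to \<open>D\<close>.\<close>
  have d': "demand \<sigma> $ j \<ge> 2 + 2 * (\<kappa> * \<delta>) + 2 * \<delta>"
    using d(2) by (simp add: algebra_simps)
  have \<delta>: "0 \<le> \<delta>"
    using close abs_ge_zero order_trans by blast
  note acc = air_accepts_iff[OF A feas d(1)]
  show ?thesis
  proof (cases "air_accepts A \<sigma> j")
    case True
    then have "1 \<le> z $ j"
      using acc d' z(2)[of j] \<delta> by linarith
    from lp_feasible_minus_axis[OF z_feas this] show ?thesis
      using True zy
      by (intro bexI[of _ "z - axis j 1"]) (auto simp: air_step_def inner_diff_right inner_axis)
  next
    case False
    then have "z $ j \<le> D $ j - 1"
      using acc d' z(2)[of j] close[of j] by linarith
    from lp_feasible_reject[OF z_feas this] show ?thesis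
      using False zy by (intro bexI[of _ z]) (auto simp: air_step_def)
  qed
qed

section \<open>Hindsight values and losses along a path\<close>

locale air =
  fixes A :: "real^'n^'m" and r :: "real^'n" and \<rho> :: "real^'m"
    and solve :: "real^'m \<Rightarrow> real^'n \<Rightarrow> real^'n" and T :: nat and \<T> :: "nat set"
  assumes A_nonneg: "\<And>i j. 0 \<le> A $ i $ j"
    and r_nonneg: "\<And>j. 0 \<le> r $ j"
    and \<rho>_nonneg: "\<And>i. 0 \<le> \<rho> $ i"
    and solver: "lp_solver A r solve"
begin

text \<open>The state on which the decision of period \<open>t\<close> is based: after a possible
  resolve, before the customer is served.\<close>

definition state :: "(nat \<Rightarrow> 'n) \<Rightarrow> nat \<Rightarrow> ('m, 'n) air_state" where
  "state \<omega> t = air_resolve solve T \<T> \<omega> t (air_after A \<rho> solve T \<T> \<omega> (t - 1))"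

text \<open>The value \<phi> at the current inventory and the true remaining demand;
  \<open>solve\<close> serves only as some maximizer.\<close>

definition hindsight :: "(nat \<Rightarrow> 'n) \<Rightarrow> nat \<Rightarrow> real" where
  "hindsight \<omega> t = r \<bullet> solve (inventory (state \<omega> t)) (remaining T \<omega> t)"

definition reward :: "(nat \<Rightarrow> 'n) \<Rightarrow> nat \<Rightarrow> real" where
  "reward \<omega> t = (if air_policy A \<rho> solve T \<T> \<omega> t then r $ \<omega> t else 0)"

definition loss :: "(nat \<Rightarrow> 'n) \<Rightarrow> nat \<Rightarrow> real" where
  "loss \<omega> t = hindsight \<omega> t - hindsight \<omega> (Suc t) - reward \<omega> t"

text \<open>The vector \<open>\<Delta>\<^sub>s\<close> of the overview.\<close>

definition forecast_error :: "(nat \<Rightarrow> 'n) \<Rightarrow> nat \<Rightarrow> 'n \<Rightarrow> real" where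
  "forecast_error \<omega> s j = (real T - real s + 1) * p_hat \<omega> s $ j - remaining T \<omega> s $ j"

lemma inventory_resolve: "inventory (air_resolve solve T \<T> \<omega> t \<sigma>) = inventory \<sigma>"
  by (simp add: air_resolve_def Let_def)

lemma state_Suc:
  "1 \<le> t \<Longrightarrow> state \<omega> (Suc t) = air_resolve solve T \<T> \<omega> (Suc t) (air_step A (\<omega> t) (state \<omega> t))"
  by (cases t) (auto simp: state_def)

lemma inventory_state_Suc:
  "1 \<le> t \<Longrightarrow> inventory (state \<omega> (Suc t)) = inventory (air_step A (\<omega> t) (state \<omega> t))"
  by (simp add: state_Suc inventory_resolve)

lemma inventory_state_1: "inventory (state \<omega> 1) = real T *\<^sub>R \<rho>"
  by (simp add: state_def inventory_resolve)

lemma inventory_nonneg: "0 \<le> inventory (state \<omega> t)"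
proof -
  have "0 \<le> inventory (air_step A j \<sigma>)" if "0 \<le> inventory \<sigma>" for j and \<sigma> :: "('m, 'n) air_state"
    using that by (simp add: air_step_def air_accepts_def)
  then have "0 \<le> inventory (air_after A \<rho> solve T \<T> \<omega> k)" for k
    using \<rho>_nonneg by (induction k) (auto simp: vec_le_iff inventory_resolve)
  then show ?thesis
    by (simp add: state_def inventory_resolve)
qed

lemma hindsight_optimal:
  "lp_optimal A r (inventory (state \<omega> t)) (remaining T \<omega> t)
     (solve (inventory (state \<omega> t)) (remaining T \<omega> t))"
  by (rule lp_solver_optimal[OF solver inventory_nonneg remaining_nonneg])

lemma hindsight_ge:
  "z \<in> lp_feasible A (inventory (state \<omega> t)) (remaining T \<omega> t) \<Longrightarrow> r \<bullet> z \<le> hindsight \<omega> t"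
  using hindsight_optimal[of \<omega> t] by (auto simp: lp_optimal_def hindsight_def)

lemma reward_eq: "reward \<omega> t = (if air_accepts A (state \<omega> t) (\<omega> t) then r $ \<omega> t else 0)"
  by (simp add: reward_def air_policy_def state_def)

text \<open>The worst case, used on atypical paths: one period lowers each coordinate of inventory
  and demand by at most \<open>M\<close>, so Lipschitz continuity of the value applies.\<close>

lemma loss_le:
  assumes lip: "\<And>b b' d d' \<delta> y. 0 \<le> b' \<Longrightarrow> 0 \<le> d' \<Longrightarrow> 0 \<le> \<delta> \<Longrightarrow> (\<And>i. b $ i - b' $ i \<le> \<delta>) \<Longrightarrow>
      (\<And>j. d $ j - d' $ j \<le> \<delta>) \<Longrightarrow> y \<in> lp_feasible A b d \<Longrightarrow>
      \<exists>y'\<in>lp_feasible A b' d'. r \<bullet> y - L * \<delta> \<le> r \<bullet> y'"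
    and M: "1 \<le> M" "\<And>i j. A $ i $ j \<le> M"
    and t: "1 \<le> t" "t \<le> T"
  shows "loss \<omega> t \<le> L * M"
proof -
  have M0: "0 \<le> M"
    using M(1) by simp
  have "inventory (state \<omega> t) $ i - inventory (state \<omega> (Suc t)) $ i \<le> M" for i
    using M(2)[of i "\<omega> t"] M0 t(1) by (simp add: inventory_state_Suc air_step_def column_def)
  moreover have "remaining T \<omega> t $ j - remaining T \<omega> (Suc t) $ j \<le> M" for j
    using M t(2) by (simp add: remaining_Suc axis_def)
  moreover have "solve (inventory (state \<omega> t)) (remaining T \<omega> t) \<in>
      lp_feasible A (inventory (state \<omega> t)) (remaining T \<omega> t)"
    using hindsight_optimal by (simp add: lp_optimal_def)
  ultimately obtain y where
    "y \<in> lp_feasible A (inventory (state \<omega> (Suc t))) (remaining T \<omega> (Suc t))"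
    "hindsight \<omega> t - L * M \<le> r \<bullet> y"
    using lip[OF inventory_nonneg remaining_nonneg M0] unfolding hindsight_def by blast
  with hindsight_ge[OF this(1)] have "hindsight \<omega> t - hindsight \<omega> (Suc t) \<le> L * M"
    by linarith
  moreover have "0 \<le> reward \<omega> t"
    using r_nonneg by (simp add: reward_def)
  ultimately show ?thesis
    by (simp add: loss_def)
qed

text \<open>The hindsight values telescope, and the last one vanishes because no demand remains
  after period \<open>T\<close>.\<close>

lemma sum_reward: "(\<Sum>t=1..T. reward \<omega> t) = hindsight \<omega> 1 - (\<Sum>t=1..T. loss \<omega> t)"
proof -
  have "(\<Sum>t=1..T. loss \<omega> t) = - (\<Sum>t=1..T. hindsight \<omega> (Suc t) - hindsight \<omega> t) - (\<Sum>t=1..T. reward \<omega> t)"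
    by (simp add: loss_def sum_subtractf)
  also have "(\<Sum>t=1..T. hindsight \<omega> (Suc t) - hindsight \<omega> t) = hindsight \<omega> (Suc T) - hindsight \<omega> 1"
    by (subst sum_Suc_diff) auto
  also have "hindsight \<omega> (Suc T) = 0"
  proof -
    have "solve (inventory (state \<omega> (Suc T))) 0 = 0"
      using hindsight_optimal[of \<omega> "Suc T"]
      by (auto simp: remaining_beyond lp_optimal_def lp_feasible_def intro: antisym)
    then show ?thesis
      by (simp add: hindsight_def remaining_beyond)
  qed
  finally show ?thesis
    by simp
qed

text \<open>Each arrival lowers forecast and true demand by the same unit vector, which freezes
  their difference. Optimality persists by \<open>air_step_optimal\<close>; the demand above 2 that
  it needs holds throughout the epoch, since \<open>remaining\<close> only decreases in
  time.\<close>

lemma epoch_invariant: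
  assumes s: "s \<in> \<T>" "1 \<le> s" "s \<le> t" "t \<le> T" and epoch: "\<T> \<inter> {s<..t} = {}"
    and err: "\<And>j. \<bar>forecast_error \<omega> s j\<bar> \<le> \<delta>" and D: "\<And>j. 2 + \<delta> < remaining T \<omega> t $ j"
  shows "lp_optimal A r (inventory (state \<omega> t)) (demand (state \<omega> t)) (quota (state \<omega> t)) \<and>
    (\<forall>j. demand (state \<omega> t) $ j = remaining T \<omega> t $ j + forecast_error \<omega> s j)"
  using s(3,4) epoch D
proof (induction t rule: dec_induct)
  case base
  define d where "d = (real T - real s + 1) *\<^sub>R p_hat \<omega> s"
  have "0 \<le> d"
    using base by (simp add: d_def vec_le_iff p_hat_def)
  then show ?case
    using s(1) inventory_nonneg[of \<omega> s] lp_solver_optimal[OF solver, of "inventory (state \<omega> s)" d]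
    by (auto simp: state_def air_resolve_def Let_def d_def forecast_error_def)
next
  case (step t)
  have 1: "1 \<le> t" "t \<le> T"
    using step s(2) by auto
  have D: "2 + \<delta> < remaining T \<omega> t $ j" for j
    using step.prems(3)[of j] remaining_antimono[of t "Suc t" T \<omega> j] by simp
  have IH: "lp_optimal A r (inventory (state \<omega> t)) (demand (state \<omega> t)) (quota (state \<omega> t))"
    "demand (state \<omega> t) $ j = remaining T \<omega> t $ j + forecast_error \<omega> s j" for j
    using step.IH[OF 1(2) _ D] step.prems(2) by fastforce+
  have "Suc t \<notin> \<T>"
    using step by auto
  then have eq: "state \<omega> (Suc t) = air_step A (\<omega> t) (state \<omega> t)"
    using 1 by (simp add: state_Suc air_resolve_def)
  have "2 < demand (state \<omega> t) $ \<omega> t"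
    using D[of "\<omega> t"] err[of "\<omega> t"] IH(2)[of "\<omega> t"] by simp
  from air_step_optimal[OF A_nonneg IH(1) this eq] show ?case
    using 1 by (simp add: eq demand_air_step remaining_Suc IH(2))
qed

text \<open>Of the multiple \<open>2 * \<kappa> + 3\<close>, one \<delta> pays for replacing true by
  forecast demand; the rest is the margin that \<open>air_step_no_loss\<close> asks for.\<close>

lemma loss_nonpos:
  assumes stab: "\<And>b d d' \<delta> u y. 0 \<le> b \<Longrightarrow> 0 \<le> d \<Longrightarrow> (\<And>j. \<bar>d $ j - d' $ j\<bar> \<le> \<delta>) \<Longrightarrow>
      lp_optimal A r b d u \<Longrightarrow> lp_optimal A r b d' y \<Longrightarrow>
      \<exists>z. lp_optimal A r b d' z \<and> (\<forall>j. \<bar>z $ j - u $ j\<bar> \<le> \<kappa> * \<delta>)"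
    and \<kappa>: "0 \<le> \<kappa>"
    and s: "s \<in> \<T>" "1 \<le> s" "s \<le> t" "t \<le> T" and epoch: "\<T> \<inter> {s<..t} = {}"
    and err: "\<And>j. \<bar>forecast_error \<omega> s j\<bar> \<le> \<delta>"
    and D: "\<And>j. 2 + (2 * \<kappa> + 3) * \<delta> < remaining T \<omega> t $ j"
  shows "loss \<omega> t \<le> 0"
proof -
  have \<delta>: "0 \<le> \<delta>"
    using err abs_ge_zero order_trans by blast
  have "0 \<le> \<kappa> * \<delta>"
    using \<kappa> \<delta> by simp
  have D': "2 + (2 * (\<kappa> * \<delta>) + 3 * \<delta>) < remaining T \<omega> t $ j" for j
    using D[of j] by (simp add: algebra_simps)
  have "2 + \<delta> < remaining T \<omega> t $ j" for j
    using D'[of j] \<delta> \<open>0 \<le> \<kappa> * \<delta>\<close> by linarith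
  from epoch_invariant[OF s epoch err this]
  have inv: "lp_optimal A r (inventory (state \<omega> t)) (demand (state \<omega> t)) (quota (state \<omega> t))"
    "demand (state \<omega> t) $ j = remaining T \<omega> t $ j + forecast_error \<omega> s j" for j
    by auto
  have dem: "2 < demand (state \<omega> t) $ \<omega> t" "2 + 2 * (\<kappa> + 1) * \<delta> \<le> demand (state \<omega> t) $ \<omega> t"
  proof -
    have "2 + 2 * (\<kappa> * \<delta>) + 2 * \<delta> < demand (state \<omega> t) $ \<omega> t"
      using D'[of "\<omega> t"] err[of "\<omega> t"] inv(2)[of "\<omega> t"] by simp
    then show "2 < demand (state \<omega> t) $ \<omega> t" "2 + 2 * (\<kappa> + 1) * \<delta> \<le> demand (state \<omega> t) $ \<omega> t"
      using \<delta> \<open>0 \<le> \<kappa> * \<delta>\<close> by (auto simp: algebra_simps)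
  qed
  have t: "1 \<le> t"
    using s by simp
  have "\<bar>demand (state \<omega> t) $ j - remaining T \<omega> t $ j\<bar> \<le> \<delta>" for j
    using err[of j] by (simp add: inv(2))
  from air_step_no_loss[where y = "solve (inventory (state \<omega> t)) (remaining T \<omega> t)",
      OF A_nonneg stab inventory_nonneg inv(1) hindsight_optimal this dem]
  have "\<exists>z\<in>lp_feasible A (inventory (state \<omega> (Suc t))) (remaining T \<omega> (Suc t)).
      hindsight \<omega> t \<le> r \<bullet> z + reward \<omega> t"
    using s(4) t by (simp add: inventory_state_Suc remaining_Suc hindsight_def reward_eq)
  then obtain z where "z \<in> lp_feasible A (inventory (state \<omega> (Suc t))) (remaining T \<omega> (Suc t))"
    "hindsight \<omega> t \<le> r \<bullet> z + reward \<omega> t"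
    by blast
  with hindsight_ge[OF this(1)] show ?thesis
    by (simp add: loss_def)
qed

end

subsection \<open>Concentration and spacing of the resolving times\<close>

lemma map_pmf_eq_bernoulli: "map_pmf (\<lambda>x. x = j) p = bernoulli_pmf (pmf p j)"
proof (rule pmf_eqI)
  fix b
  have "(\<lambda>x. x = j) -` {True} = {j}"
    by auto
  then have True: "pmf (map_pmf (\<lambda>x. x = j) p) True = pmf p j"
    by (simp add: pmf_map measure_pmf_single)
  show "pmf (map_pmf (\<lambda>x. x = j) p) b = pmf (bernoulli_pmf (pmf p j)) b"
    using True by (cases b) (auto simp: pmf_False_conv_True pmf_nonneg pmf_le_1)
qed

lemma window_count_binomial:
  assumes S: "S \<subseteq> {1..T}"
  shows "map_pmf (\<lambda>\<omega>. card {s \<in> S. \<omega> s = j}) (arrivals p T) = binomial_pmf (card S) (pmf p j)"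
proof -
  have fin: "finite S"
    using S finite_subset by blast
  \<comment> \<open>The default outside \<open>S\<close> has to be the image of
    \<open>undefined\<close> under the test \<open>x = j\<close>, so that the product of Bernoulli
    variables is an image of the product of copies of \<open>p\<close>.\<close>
  have "binomial_pmf (card S) (pmf p j) = map_pmf (\<lambda>f. card {s \<in> S. f s})
      (Pi_pmf S (undefined = j) (\<lambda>_. bernoulli_pmf (pmf p j)))"
    by (rule binomial_pmf_altdef') (use fin in \<open>auto simp: pmf_nonneg pmf_le_1\<close>)
  also have "Pi_pmf S (undefined = j) (\<lambda>_. bernoulli_pmf (pmf p j)) =
      map_pmf (\<lambda>h. (\<lambda>x. x = j) \<circ> h) (Pi_pmf S undefined (\<lambda>_. p))"
    unfolding map_pmf_eq_bernoulli[symmetric] by (rule Pi_pmf_map[OF fin refl])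
  also have "Pi_pmf S undefined (\<lambda>_. p) =
      map_pmf (\<lambda>f x. if x \<in> S then f x else undefined) (arrivals p T)"
    unfolding arrivals_def by (rule Pi_pmf_subset) (use S in auto)
  finally show ?thesis
    by (auto simp: map_pmf_comp o_def intro!: map_pmf_cong arg_cong[where f = card])
qed

text \<open>Hoeffding's inequality for the binomial distribution.\<close>

lemma window_count_tail:
  assumes S: "S \<subseteq> {1..T}" "S \<noteq> {}" and x: "0 \<le> x"
  shows "measure_pmf.prob (arrivals p T) {\<omega>. x \<le> \<bar>window_count \<omega> S j - real (card S) * pmf p j\<bar>}
    \<le> 2 * exp (- 2 * x\<^sup>2 / real (card S))"
proof -
  have "0 < card S"
    using S finite_subset by (auto simp: card_gt_0_iff)
  have "binomial_distribution (pmf p j)"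
    by unfold_locales (auto simp: pmf_nonneg pmf_le_1)
  from binomial_distribution.prob_abs_ge[OF this \<open>0 < card S\<close> x] show ?thesis
    unfolding window_count_binomial[OF S(1), of j p, symmetric]
    by (simp add: window_count_def vimage_def)
qed

lemma finite_set_pmf_arrivals: "finite (set_pmf (arrivals p T))" for p :: "'n::finite pmf"
proof -
  have "set_pmf (arrivals p T) \<subseteq> PiE_dflt {1..T} undefined (\<lambda>_. UNIV)"
    unfolding arrivals_def by (subst set_Pi_pmf) (auto simp: PiE_dflt_def)
  then show ?thesis
    by (rule finite_subset) auto
qed

lemma prob_Union_le:
  fixes E :: "'n::finite \<Rightarrow> 'a set"
  assumes "\<And>j. measure_pmf.prob M (E j) \<le> q"
  shows "measure_pmf.prob M (\<Union>j. E j) \<le> real CARD('n) * q"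
proof -
  have "measure_pmf.prob M (\<Union>j. E j) \<le> (\<Sum>j\<in>UNIV. measure_pmf.prob M (E j))"
    by (rule measure_UNION_le) auto
  also have "\<dots> \<le> (\<Sum>j\<in>(UNIV :: 'n set). q)"
    by (intro sum_mono assms)
  finally show ?thesis
    by simp
qed

text \<open>
  The last threshold is scaled so that the demand forecast made at \<open>s\<close> from the sample frequencies
  is off by less than \<open>x\<close> as well.
\<close>

definition typical :: "'n::finite pmf \<Rightarrow> nat \<Rightarrow> nat \<Rightarrow> nat \<Rightarrow> real \<Rightarrow> (nat \<Rightarrow> 'n) \<Rightarrow> bool" where
  "typical p T s t x \<omega> \<longleftrightarrow> (\<forall>j.
     \<bar>window_count \<omega> {t..T} j - real (card {t..T}) * pmf p j\<bar> < x \<and>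
     \<bar>window_count \<omega> {s..T} j - real (card {s..T}) * pmf p j\<bar> < x \<and>
     \<bar>window_count \<omega> {1..<s} j - real (card {1..<s}) * pmf p j\<bar> <
       x * (real s - 1) / (real T - real s + 1))"

text \<open>For the three windows Hoeffding's exponents are \<open>2 * \<eta>\<^sup>2\<close> times
  \<open>R\<close>, \<open>R\<^sup>2 / W\<close> and \<open>R\<^sup>2 * (s - 1) / W\<^sup>2\<close>;
  the first is at least the second as \<open>R \<le> W\<close>, so \<open>m\<close> bounds all three
  from below. Three two-sided tails give the factor 6, the union over types the factor
  \<open>CARD('n)\<close>.\<close>

lemma prob_not_typical:
  fixes p :: "'n::finite pmf"
  assumes "2 \<le> s" "s \<le> t" "t \<le> T" "0 < \<eta>"
  defines "R \<equiv> real T - real t + 1" and "W \<equiv> real T - real s + 1"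
  assumes m: "m \<le> R\<^sup>2 / W" "m \<le> R\<^sup>2 * (real s - 1) / W\<^sup>2"
  shows "measure_pmf.prob (arrivals p T) {\<omega>. \<not> typical p T s t (\<eta> * R) \<omega>}
    \<le> 6 * real CARD('n) * exp (- 2 * \<eta>\<^sup>2 * m)"
proof -
  let ?P = "measure_pmf.prob (arrivals p T)"
  have RW: "0 < R" "R \<le> W" "0 < W"
    using assms by (auto simp: R_def W_def)
  define E1 where "E1 S x j = {\<omega>. x \<le> \<bar>window_count \<omega> S j - real (card S) * pmf p j\<bar>}" for S x and j :: 'n
  define x where "x = \<eta> * R * (real s - 1) / W"
  have card: "real (card {t..T}) = R" "real (card {s..T}) = W" "real (card {1..<s}) = real s - 1"
    using assms by (auto simp: R_def W_def of_nat_diff)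
  have mono: "2 * exp (- 2 * \<eta>\<^sup>2 * y) \<le> 2 * exp (- 2 * \<eta>\<^sup>2 * m)" if "m \<le> y" for y
    using mult_left_mono[OF that, of "\<eta>\<^sup>2"] by simp
  have "R * R \<le> R * W"
    using RW by (intro mult_left_mono) auto
  then have "R\<^sup>2 / W \<le> R"
    using RW by (simp add: pos_divide_le_eq power2_eq_square)
  then have "m \<le> R"
    using m(1) by simp
  have "?P (E1 {t..T} (\<eta> * R) j) \<le> 2 * exp (- 2 * \<eta>\<^sup>2 * m)" for j
  proof -
    have "?P (E1 {t..T} (\<eta> * R) j) \<le> 2 * exp (- 2 * (\<eta> * R)\<^sup>2 / R)"
      unfolding E1_def card(1)[symmetric] by (rule window_count_tail) (use assms RW in auto)
    also have "- 2 * (\<eta> * R)\<^sup>2 / R = - 2 * \<eta>\<^sup>2 * R"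
      using RW by (simp add: power2_eq_square)
    also have "2 * exp (- 2 * \<eta>\<^sup>2 * R) \<le> 2 * exp (- 2 * \<eta>\<^sup>2 * m)"
      by (rule mono[OF \<open>m \<le> R\<close>])
    finally show ?thesis .
  qed
  moreover have "?P (E1 {s..T} (\<eta> * R) j) \<le> 2 * exp (- 2 * \<eta>\<^sup>2 * m)" for j
  proof -
    have "?P (E1 {s..T} (\<eta> * R) j) \<le> 2 * exp (- 2 * (\<eta> * R)\<^sup>2 / W)"
      unfolding E1_def card(2)[symmetric] by (rule window_count_tail) (use assms RW in auto)
    also have "- 2 * (\<eta> * R)\<^sup>2 / W = - 2 * \<eta>\<^sup>2 * (R\<^sup>2 / W)"
      by (simp add: power_mult_distrib)
    also have "2 * exp (- 2 * \<eta>\<^sup>2 * (R\<^sup>2 / W)) \<le> 2 * exp (- 2 * \<eta>\<^sup>2 * m)"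
      by (rule mono[OF m(1)])
    finally show ?thesis .
  qed
  moreover have "?P (E1 {1..<s} x j) \<le> 2 * exp (- 2 * \<eta>\<^sup>2 * m)" for j
  proof -
    have "?P (E1 {1..<s} x j) \<le> 2 * exp (- 2 * x\<^sup>2 / (real s - 1))"
      unfolding E1_def card(3)[symmetric] by (rule window_count_tail) (use assms RW in \<open>auto simp: x_def\<close>)
    also have "- 2 * x\<^sup>2 / (real s - 1) = - 2 * \<eta>\<^sup>2 * (R\<^sup>2 * (real s - 1) / W\<^sup>2)"
      using assms(1) by (simp add: x_def power_mult_distrib power_divide) (simp add: power2_eq_square)
    also have "2 * exp (- 2 * \<eta>\<^sup>2 * (R\<^sup>2 * (real s - 1) / W\<^sup>2)) \<le> 2 * exp (- 2 * \<eta>\<^sup>2 * m)"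
      by (rule mono[OF m(2)])
    finally show ?thesis .
  qed
  moreover have "?P (X \<union> Y \<union> Z) \<le> ?P X + ?P Y + ?P Z" for X Y Z
    using measure_Un_le[of "X \<union> Y" "arrivals p T" Z] measure_Un_le[of X "arrivals p T" Y] by simp
  ultimately have "?P (E1 {t..T} (\<eta> * R) j \<union> E1 {s..T} (\<eta> * R) j \<union> E1 {1..<s} x j)
      \<le> 6 * exp (- 2 * \<eta>\<^sup>2 * m)" for j
    by (smt (verit))
  from prob_Union_le[OF this]
  have "?P (\<Union>j. E1 {t..T} (\<eta> * R) j \<union> E1 {s..T} (\<eta> * R) j \<union> E1 {1..<s} x j)
      \<le> real CARD('n) * (6 * exp (- 2 * \<eta>\<^sup>2 * m))" .
  moreover have "{\<omega>. \<not> typical p T s t (\<eta> * R) \<omega>} =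
      (\<Union>j. E1 {t..T} (\<eta> * R) j \<union> E1 {s..T} (\<eta> * R) j \<union> E1 {1..<s} x j)"
    by (auto simp: typical_def E1_def x_def W_def not_less)
  ultimately show ?thesis
    by simp
qed

text \<open>The error splits at \<open>W * pmf p j\<close> into the scaled sampling error of the
  past and the deviation of the future arrivals, each at most \<open>x\<close>.\<close>

lemma (in air) typical_forecast:
  assumes "typical p T s t x \<omega>" "2 \<le> s" "s \<le> T" "t \<le> T"
  shows "\<bar>forecast_error \<omega> s j\<bar> \<le> 2 * x"
    and "(real T - real t + 1) * pmf p j - x < remaining T \<omega> t $ j"
proof -
  define W where "W = real T - real s + 1"
  have W: "0 < W" and s1: "0 < real s - 1"
    using assms by (auto simp: W_def)
  have card: "real (card {t..T}) = real T - real t + 1" "real (card {s..T}) = W"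
    "real (card {1..<s}) = real s - 1"
    using assms by (auto simp: W_def of_nat_diff)
  note ty = assms(1)[unfolded typical_def card, folded W_def, rule_format, of j]
  show "(real T - real t + 1) * pmf p j - x < remaining T \<omega> t $ j"
    using ty by (auto simp: remaining_def)
  have phat: "p_hat \<omega> s $ j = window_count \<omega> {1..<s} j / (real s - 1)"
    using assms(2) by (simp add: p_hat_def arrival_count_def window_count_def of_nat_diff)
  have "\<bar>W * p_hat \<omega> s $ j - W * pmf p j\<bar> =
      \<bar>window_count \<omega> {1..<s} j - (real s - 1) * pmf p j\<bar> * (W / (real s - 1))"
  proof -
    have "W * p_hat \<omega> s $ j - W * pmf p j =
        (window_count \<omega> {1..<s} j - (real s - 1) * pmf p j) * (W / (real s - 1))"
      using s1 by (simp add: phat field_simps)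
    then show ?thesis
      using W s1 by (simp add: abs_mult)
  qed
  also have "\<dots> \<le> (x * (real s - 1) / W) * (W / (real s - 1))"
    using ty W s1 by (intro mult_right_mono) auto
  also have "\<dots> = x"
    using W s1 by simp
  finally show "\<bar>forecast_error \<omega> s j\<bar> \<le> 2 * x"
    using ty by (auto simp: forecast_error_def remaining_def W_def[symmetric])
qed

section \<open>Spacing of the resolving times\<close>

lemma powr_resolve_count:
  assumes \<gamma>: "0 < \<gamma>" "\<gamma> < 1" and T: "3 < T"
  shows "1 \<le> resolve_count \<gamma> T" "real T powr (\<gamma> ^ nat (resolve_count \<gamma> T)) \<le> 3"
proof -
  define x where "x = log 3 (real T)"
  have x: "1 < x"
    using T by (simp add: x_def less_log_iff)
  have l: "0 < log (1 / \<gamma>) x"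
    using \<gamma> x by (simp add: zero_less_log_cancel_iff)
  then show K1: "1 \<le> resolve_count \<gamma> T"
    by (simp add: resolve_count_def x_def)
  define k where "k = nat (resolve_count \<gamma> T)"
  \<comment> \<open>Rounding up in \<open>resolve_count\<close> yields
    \<open>\<gamma> ^ k * log 3 T \<le> 1\<close>, which says that the last power in the grid is at
    most 3.\<close>
  have "log (1 / \<gamma>) x \<le> real k"
    unfolding k_def resolve_count_def x_def by linarith
  then have "x \<le> (1 / \<gamma>) powr real k"
    using \<gamma> x by (simp add: log_le_iff)
  also have "\<dots> = 1 / \<gamma> ^ k"
    using \<gamma> by (simp add: powr_realpow power_one_over)
  finally have "\<gamma> ^ k * x \<le> 1"
    using \<gamma> by (simp add: field_simps)
  then have "log 3 (real T powr (\<gamma> ^ k)) \<le> 1"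
    using T by (simp add: x_def log_powr)
  then show "real T powr (\<gamma> ^ k) \<le> 3"
    using T by (simp add: log_le_iff)
qed

text \<open>Up to rounding, each learning time is the \<alpha>-th power of the one after it, or of
  \<open>T\<close>. The latest one not after \<open>t\<close> therefore follows from a bound on its
  successor, which lies beyond \<open>t\<close>.\<close>

lemma learning_time_before:
  assumes \<alpha>: "0 < \<alpha>" "\<alpha> < 1" and T: "3 < T" and t: "3 \<le> t" "t \<le> T"
  obtains s where "s \<in> learning_times \<alpha> T" "s \<le> t" "real t powr \<alpha> \<le> real s"
proof -
  define \<tau> where "\<tau> k = nat \<lceil>real T powr (\<alpha> ^ k)\<rceil>" for k
  define K where "K = nat (resolve_count \<alpha> T)"
  have K: "1 \<le> K" "\<tau> K \<le> t"
    using powr_resolve_count[OF \<alpha> T] t by (auto simp: K_def \<tau>_def ceiling_le_iff)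
  \<comment> \<open>The times decrease in \<open>k\<close>, so the least index gives the latest
    time; \<open>K\<close> qualifies because \<open>\<tau> K \<le> 3\<close>.\<close>
  define k where "k = (LEAST k. 1 \<le> k \<and> \<tau> k \<le> t)"
  have k: "1 \<le> k" "\<tau> k \<le> t" "k \<le> K"
    using LeastI[of "\<lambda>k. 1 \<le> k \<and> \<tau> k \<le> t" K] Least_le[of "\<lambda>k. 1 \<le> k \<and> \<tau> k \<le> t" K] K
    by (auto simp: k_def)
  have "\<tau> k \<in> learning_times \<alpha> T"
    using k powr_resolve_count(1)[OF \<alpha> T] unfolding learning_times_def \<tau>_def K_def by auto
  moreover have "real t powr \<alpha> \<le> real T powr (\<alpha> ^ k)"
  proof (cases "k = 1")
    case True
    then show ?thesis
      using t \<alpha> by (simp add: powr_mono2)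
  next
    case False
    define l where "l = k - 1"
    have l: "k = Suc l" "1 \<le> l"
      using False k(1) by (auto simp: l_def)
    have "\<not> \<tau> l \<le> t"
      using not_less_Least[of l "\<lambda>k. 1 \<le> k \<and> \<tau> k \<le> t"] l by (auto simp: k_def)
    then have "real t \<le> real T powr (\<alpha> ^ l)"
      unfolding \<tau>_def by linarith
    then have "real t powr \<alpha> \<le> (real T powr (\<alpha> ^ l)) powr \<alpha>"
      using \<alpha> by (intro powr_mono2) auto
    then show ?thesis
      by (simp add: l(1) powr_powr mult.commute)
  qed
  then have "real t powr \<alpha> \<le> real (\<tau> k)"
    unfolding \<tau>_def by linarith
  ultimately show ?thesis
    using that k(2) by blast
qed

text \<open>The same argument on the remaining horizon: \<open>R\<close> lies between consecutive
  powers with exponents \<open>\<beta> ^ k\<close> and \<open>\<beta> ^ l\<close>, where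
  \<open>k = Suc l\<close>. The larger power marks a resolve before \<open>t\<close> and is the
  \<open>1 / \<beta>\<close>-th power of the smaller one, hence at most
  \<open>R powr (1 / \<beta>)\<close>.\<close>

lemma allocation_time_before:
  assumes \<beta>: "0 < \<beta>" "\<beta> < 1" and T: "3 < T" "real T powr \<beta> \<le> real T / 2"
    and t: "real T / 2 \<le> real t" "t \<le> T" and R: "R = real T - real t + 1" "3 < R"
  obtains s where "s \<in> learning_times \<alpha> T \<union> allocation_times \<beta> T" "s \<le> t"
    "real T / 2 \<le> real s" "real T - real s \<le> R powr (1 / \<beta>)"
proof -
  define K where "K = nat (resolve_count \<beta> T)"
  have K: "real T powr (\<beta> ^ K) \<le> 3"
    using powr_resolve_count[OF \<beta> T(1)] by (simp add: K_def)
  define k where "k = (LEAST k. real T powr (\<beta> ^ k) < R)"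
  have k: "real T powr (\<beta> ^ k) < R" "k \<le> K"
    using LeastI[of "\<lambda>k. real T powr (\<beta> ^ k) < R" K] Least_le[of "\<lambda>k. real T powr (\<beta> ^ k) < R" K] K R(2)
    by (auto simp: k_def)
  have "k \<noteq> 0"
  proof
    assume "k = 0"
    then have "real T < R"
      using k(1) T by simp
    then show False
      using R(1) t T(1) by simp
  qed
  define l where "l = k - 1"
  have l: "k = Suc l"
    using \<open>k \<noteq> 0\<close> by (simp add: l_def)
  have Rl: "R \<le> real T powr (\<beta> ^ l)"
    using not_less_Least[of l "\<lambda>k. real T powr (\<beta> ^ k) < R"] l by (auto simp: k_def)
  have Tl: "real T powr (\<beta> ^ l) \<le> R powr (1 / \<beta>)"
  proof -
    have "(real T powr (\<beta> ^ l)) = (real T powr (\<beta> ^ k)) powr (1 / \<beta>)"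
      using \<beta> by (simp add: l powr_powr)
    also have "\<dots> \<le> R powr (1 / \<beta>)"
      using k(1) \<beta> by (intro powr_mono2) auto
    finally show ?thesis .
  qed
  show ?thesis
  proof (cases "l = 0")
    \<comment> \<open>The allocation grid starts at exponent \<open>\<beta> ^ 1\<close>, so the
      resolve at half the horizon takes over; here even \<open>T\<close> is at most
      \<open>R powr (1 / \<beta>)\<close>.\<close>
    case True
    show ?thesis
    proof (rule that[of "nat \<lceil>real T / 2\<rceil>"])
      show "nat \<lceil>real T / 2\<rceil> \<in> learning_times \<alpha> T \<union> allocation_times \<beta> T"
        by (simp add: learning_times_def)
      show "nat \<lceil>real T / 2\<rceil> \<le> t" "real T / 2 \<le> real (nat \<lceil>real T / 2\<rceil>)"
        using t(1) by linarith+
      have "real T - real (nat \<lceil>real T / 2\<rceil>) \<le> real T"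
        by simp
      also have "\<dots> \<le> R powr (1 / \<beta>)"
        using Tl True T(1) by simp
      finally show "real T - real (nat \<lceil>real T / 2\<rceil>) \<le> R powr (1 / \<beta>)" .
    qed
  next
    case False
    define s where "s = nat \<lceil>real T - real T powr (\<beta> ^ l)\<rceil>"
    \<comment> \<open>The assumption on \<open>T powr \<beta>\<close> keeps the allocation times in
      the second half, where at least about \<open>T / 2\<close> samples are available.\<close>
    have "real T powr (\<beta> ^ l) \<le> real T powr \<beta>"
      using False \<beta> T(1) power_decreasing[of 1 l \<beta>] by (intro powr_mono) auto
    then have half: "real T / 2 \<le> real T - real T powr (\<beta> ^ l)"
      using T(2) by simp
    show ?thesis
    proof (rule that[of s])
      have "1 \<le> l" "int l \<le> resolve_count \<beta> T"
        using False k(2) l by (auto simp: K_def)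
      then show "s \<in> learning_times \<alpha> T \<union> allocation_times \<beta> T"
        by (auto simp: allocation_times_def s_def)
      show "s \<le> t"
        using Rl R(1) unfolding s_def by linarith
      show "real T / 2 \<le> real s"
        using half unfolding s_def by linarith
      show "real T - real s \<le> R powr (1 / \<beta>)"
        using Tl unfolding s_def by linarith
    qed
  qed
qed

lemma last_element_before:
  assumes "s' \<in> S" "s' \<le> (t::nat)"
  obtains s where "s \<in> S" "s' \<le> s" "s \<le> t" "S \<inter> {s<..t} = {}"
proof -
  have fin: "finite (S \<inter> {..t})"
    by simp
  show ?thesis
  proof (rule that[of "Max (S \<inter> {..t})"])
    have "Max (S \<inter> {..t}) \<in> S \<inter> {..t}"
      using assms by (intro Max_in) auto
    then show "Max (S \<inter> {..t}) \<in> S" "Max (S \<inter> {..t}) \<le> t"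
      by auto
    show "s' \<le> Max (S \<inter> {..t})"
      using assms by (intro Max_ge) auto
    show "S \<inter> {Max (S \<inter> {..t})<..t} = {}"
      using Max_ge[OF fin] by (fastforce simp: not_le[symmetric])
  qed
qed

text \<open>Here \<open>m\<close> bounds from below the exponents of
  \<open>prob_not_typical\<close>, with \<open>W = T - s + 1\<close>. In the first half
  \<open>R \<ge> T / 2\<close> and \<open>W \<le> T\<close>, and sample size is the bottleneck:
  \<open>s \<ge> t powr \<alpha>\<close>. In the second half \<open>s - 1 \<ge> W / 2\<close>, and
  \<open>W \<le> 2 * R powr (1 / \<beta>)\<close> is decisive. Passing from \<open>s'\<close> to the
  last resolve \<open>s\<close> preserves these bounds.\<close>

lemma last_resolve:
  assumes \<alpha>: "0 < \<alpha>" "\<alpha> < 1" and \<beta>: "1 / 2 < \<beta>" "\<beta> < 1"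
    and T: "6 \<le> T" "real T powr \<beta> \<le> real T / 2"
    and t: "3 \<le> t" "t \<le> T" and R: "R = real T - real t + 1" "3 < R"
    and \<T>: "\<T> = learning_times \<alpha> T \<union> allocation_times \<beta> T"
  obtains s m where "s \<in> \<T>" "2 \<le> s" "s \<le> t" "\<T> \<inter> {s<..t} = {}"
    "m \<le> R\<^sup>2 / (real T - real s + 1)" "m \<le> R\<^sup>2 * (real s - 1) / (real T - real s + 1)\<^sup>2"
    "m = (real t powr \<alpha> - 1) / 4 \<or> m = R powr (2 - 1 / \<beta>) / 4"
proof (cases "real t < real T / 2")
  case True
  obtain s' where s': "s' \<in> learning_times \<alpha> T" "s' \<le> t" "real t powr \<alpha> \<le> real s'"
    using learning_time_before[OF \<alpha> _ t] T by auto
  obtain s where s: "s \<in> \<T>" "s' \<le> s" "s \<le> t" "\<T> \<inter> {s<..t} = {}"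
    using last_element_before[of s' \<T> t] s' \<T> by auto
  have ts: "real t powr \<alpha> \<le> real s"
    using s s' by linarith
  have "1 powr \<alpha> < real t powr \<alpha>"
    using t \<alpha> by (intro powr_less_mono2) auto
  then have s2: "2 \<le> s"
    using ts by simp
  define W where "W = real T - real s + 1"
  have W: "0 < W" "W \<le> T"
    using s t s2 by (auto simp: W_def)
  have TR: "real T / 2 \<le> R"
    using True R by simp
  have "(real T / 2)\<^sup>2 \<le> R\<^sup>2"
    using TR by (intro power_mono) auto
  then have R2: "real T * real T \<le> 4 * R\<^sup>2"
    by (simp add: power2_eq_square)
  have ta: "real t powr \<alpha> \<le> real t"
    using t \<alpha> powr_mono[of \<alpha> 1 "real t"] by simp
  show ?thesis
  proof (rule that[OF s(1) s2 s(3,4)])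
    have "real T * W \<le> 4 * R\<^sup>2"
      using R2 mult_left_mono[OF W(2), of T] by simp
    then have "real T / 4 \<le> R\<^sup>2 / W"
      using W by (simp add: field_simps)
    then show "(real t powr \<alpha> - 1) / 4 \<le> R\<^sup>2 / (real T - real s + 1)"
      using ta t by (simp add: W_def)
    have "W\<^sup>2 \<le> 4 * R\<^sup>2"
      using R2 W mult_mono[of W T W T] by (simp add: power2_eq_square)
    then have "1 / 4 * (real s - 1) \<le> R\<^sup>2 / W\<^sup>2 * (real s - 1)"
      using W s2 by (intro mult_right_mono) (auto simp: field_simps)
    then show "(real t powr \<alpha> - 1) / 4 \<le> R\<^sup>2 * (real s - 1) / (real T - real s + 1)\<^sup>2"
      using ts by (simp add: W_def)
  qed simp
next
  case False
  obtain s' where s': "s' \<in> \<T>" "s' \<le> t" "real T / 2 \<le> real s'" "real T - real s' \<le> R powr (1 / \<beta>)"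
    using allocation_time_before[of \<beta> T t R \<alpha>] \<beta> T t R False \<T> by auto
  obtain s where s: "s \<in> \<T>" "s' \<le> s" "s \<le> t" "\<T> \<inter> {s<..t} = {}"
    using last_element_before[of s' \<T> t] s' by auto
  have s2: "2 \<le> s"
    using s s' T by linarith
  define W where "W = real T - real s + 1"
  have sT: "real T / 2 \<le> real s"
    using s s' by linarith
  have W: "0 < W" "W \<le> R powr (1 / \<beta>) + 1"
    using s t s' by (auto simp: W_def)
  have "1 \<le> R powr (1 / \<beta>)"
    using R \<beta> by (intro ge_one_powr_ge_zero) auto
  then have W': "W \<le> 2 * R powr (1 / \<beta>)"
    using W by simp
  have "R powr (2 - 1 / \<beta>) / 2 * W \<le> R powr (2 - 1 / \<beta>) / 2 * (2 * R powr (1 / \<beta>))"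
    using W' by (intro mult_left_mono) auto
  also have "\<dots> = R\<^sup>2"
    using R by (simp add: powr_add[symmetric])
  finally have m: "R powr (2 - 1 / \<beta>) / 2 \<le> R\<^sup>2 / W"
    using W by (simp add: field_simps)
  show ?thesis
  proof (rule that[OF s(1) s2 s(3,4)])
    show "R powr (2 - 1 / \<beta>) / 4 \<le> R\<^sup>2 / (real T - real s + 1)"
      using m powr_ge_zero[of R "2 - 1 / \<beta>"] unfolding W_def[symmetric] by linarith
    \<comment> \<open>With \<open>s \<ge> T / 2\<close> this amounts to
      \<open>T \<ge> 6\<close>.\<close>
    have "W \<le> 2 * (real s - 1)"
      using sT T by (simp add: W_def)
    then have "1 / 2 \<le> (real s - 1) / W"
      using W by (simp add: field_simps)
    with m have "R powr (2 - 1 / \<beta>) / 2 * (1 / 2) \<le> R\<^sup>2 / W * ((real s - 1) / W)"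
      using W by (intro mult_mono) auto
    then show "R powr (2 - 1 / \<beta>) / 4 \<le> R\<^sup>2 * (real s - 1) / (real T - real s + 1)\<^sup>2"
      by (simp add: W_def power2_eq_square)
  qed simp
qed

lemma summable_exp_powr:
  assumes "0 < c" "0 < \<gamma>"
  shows "summable (\<lambda>n. exp (- c * real n powr \<gamma>))"
proof (rule summable_comparison_test_bigo)
  show "summable (\<lambda>n. norm (real n powr - 2))"
    by (simp add: summable_real_powr_iff)
  show "(\<lambda>n. exp (- c * real n powr \<gamma>)) \<in> O(\<lambda>n. real n powr - 2)"
    using assms by real_asymp
qed

subsection \<open>Summation of the expected losses\<close>

context air
begin

lemma integrable_arrivals [simp, intro]:
  "integrable (measure_pmf (arrivals p T)) (f :: (nat \<Rightarrow> 'n) \<Rightarrow> real)"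
  by (rule integrable_measure_pmf_finite[OF finite_set_pmf_arrivals])

text \<open>On every path the counts of accepted customers by type are a feasible point of the
  hindsight program.\<close>

lemma policy_reward_le_hindsight:
  assumes "feasible A \<rho> T \<mu>" "1 \<le> T"
  shows "(\<Sum>t=1..T. if \<mu> \<omega> t then r $ \<omega> t else 0) \<le> hindsight \<omega> 1"
proof -
  define y where "y = (\<Sum>t=1..T. if \<mu> \<omega> t then axis (\<omega> t) 1 else 0 :: real^'n)"
  have inner_y: "v \<bullet> y = (\<Sum>t=1..T. if \<mu> \<omega> t then v $ \<omega> t else 0)" for v
    by (auto simp: y_def inner_sum_right inner_axis intro!: sum.cong)
  have "row i A \<bullet> y \<le> (real T *\<^sub>R \<rho>) $ i" for i
  proof -
    have "row i A \<bullet> y = consumption A \<mu> \<omega> T $ i"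
      unfolding inner_y consumption_def sum_component
      by (intro sum.cong) (auto simp: row_def column_def)
    then show ?thesis
      using assms by (simp add: feasible_def vec_le_iff)
  qed
  moreover have "0 \<le> y $ j" for j
    unfolding y_def sum_component by (intro sum_nonneg) (auto simp: axis_def)
  moreover have "y $ j \<le> remaining T \<omega> 1 $ j" for j
  proof -
    have "y $ j \<le> (\<Sum>t=1..T. if \<omega> t = j then 1 else 0)"
      unfolding y_def sum_component by (intro sum_mono) (auto simp: axis_def)
    also have "\<dots> = remaining T \<omega> 1 $ j"
      by (simp add: remaining_def window_count_def sum.If_cases Int_def)
    finally show ?thesis .
  qed
  ultimately have "y \<in> lp_feasible A (inventory (state \<omega> 1)) (remaining T \<omega> 1)"
    unfolding lp_feasible_iff inventory_state_1 by blast
  from hindsight_ge[OF this] show ?thesis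
    by (simp add: inner_y)
qed

lemma regret_le_sum_loss:
  assumes "1 \<le> T"
  shows "regret A r \<rho> p T (air_policy A \<rho> solve T \<T>) \<le>
    (\<Sum>t=1..T. measure_pmf.expectation (arrivals p T) (\<lambda>\<omega>. loss \<omega> t))"
proof -
  let ?E = "measure_pmf.expectation (arrivals p T)"
  have "optimal_reward A r \<rho> p T \<le> ?E (\<lambda>\<omega>. hindsight \<omega> 1)"
    unfolding optimal_reward_def
  proof (rule cSUP_least)
    \<comment> \<open>Rejecting everyone shows that the supremum runs over a nonempty set.\<close>
    have "feasible A \<rho> T (\<lambda>_ _. False) \<and> non_anticipative T (\<lambda>_ _. False)"
      using \<rho>_nonneg by (simp add: feasible_def non_anticipative_def consumption_def vec_le_iff)
    then show "{\<mu>. feasible A \<rho> T \<mu> \<and> non_anticipative T \<mu>} \<noteq> {}"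
      by blast
  next
    fix \<mu> :: "'n policy"
    assume "\<mu> \<in> {\<mu>. feasible A \<rho> T \<mu> \<and> non_anticipative T \<mu>}"
    then show "expected_reward r p T \<mu> \<le> ?E (\<lambda>\<omega>. hindsight \<omega> 1)"
      unfolding expected_reward_def
      by (intro integral_mono policy_reward_le_hindsight assms integrable_arrivals) simp
  qed
  also have "?E (\<lambda>\<omega>. hindsight \<omega> 1) = ?E (\<lambda>\<omega>. (\<Sum>t=1..T. reward \<omega> t) + (\<Sum>t=1..T. loss \<omega> t))"
    unfolding sum_reward by simp
  also have "\<dots> = expected_reward r p T (air_policy A \<rho> solve T \<T>) + (\<Sum>t=1..T. ?E (\<lambda>\<omega>. loss \<omega> t))"
    by (simp add: expected_reward_def reward_def)
  finally show ?thesis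
    by (simp add: regret_def)
qed

text \<open>On typical paths the forecast error is at most \<open>2 * \<eta> * R\<close> and the
  remaining demand exceeds \<open>pmf p j * R - \<eta> * R\<close>. The requirement of
  \<open>loss_nonpos\<close> then reads \<open>2 + (2 * (2 * \<kappa> + 3) + 1) * \<eta> * R \<le>
  pmf p j * R\<close>, which explains \<open>4 * \<kappa> + 7\<close>. Other paths cost at most
  \<open>B\<close>.\<close>

lemma expected_loss_le:
  assumes stab: "\<And>b d d' \<delta> u y. 0 \<le> b \<Longrightarrow> 0 \<le> d \<Longrightarrow> (\<And>j. \<bar>d $ j - d' $ j\<bar> \<le> \<delta>) \<Longrightarrow>
      lp_optimal A r b d u \<Longrightarrow> lp_optimal A r b d' y \<Longrightarrow>
      \<exists>z. lp_optimal A r b d' z \<and> (\<forall>j. \<bar>z $ j - u $ j\<bar> \<le> \<kappa> * \<delta>)"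
    and \<kappa>: "0 \<le> \<kappa>"
    and B: "0 \<le> B" "\<And>\<omega>. loss \<omega> t \<le> B"
    and s: "s \<in> \<T>" "2 \<le> s" "s \<le> t" "t \<le> T" and epoch: "\<T> \<inter> {s<..t} = {}"
    and R: "R = real T - real t + 1"
    and m: "m \<le> R\<^sup>2 / (real T - real s + 1)" "m \<le> R\<^sup>2 * (real s - 1) / (real T - real s + 1)\<^sup>2"
    and \<eta>: "0 < \<eta>" "\<And>j. 2 + (4 * \<kappa> + 7) * \<eta> * R \<le> pmf p j * R"
  shows "measure_pmf.expectation (arrivals p T) (\<lambda>\<omega>. loss \<omega> t) \<le>
    B * (6 * real CARD('n) * exp (- 2 * \<eta>\<^sup>2 * m))"
proof -
  define Bad where "Bad = {\<omega>. \<not> typical p T s t (\<eta> * R) \<omega>}"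
  have "loss \<omega> t \<le> 0" if ty: "typical p T s t (\<eta> * R) \<omega>" for \<omega>
  proof (rule loss_nonpos[OF stab \<kappa> s(1) _ s(3,4) epoch])
    show "1 \<le> s"
      using s(2) by simp
    show "\<bar>forecast_error \<omega> s j\<bar> \<le> 2 * (\<eta> * R)" for j
      using typical_forecast(1)[OF ty s(2) _ s(4)] s by simp
    show "2 + (2 * \<kappa> + 3) * (2 * (\<eta> * R)) < remaining T \<omega> t $ j" for j
      using typical_forecast(2)[OF ty s(2) _ s(4), of j] s \<eta>(2)[of j] by (simp add: R algebra_simps)
  qed auto
  then have "loss \<omega> t \<le> B * indicator Bad \<omega>" for \<omega>
    using B by (auto simp: Bad_def indicator_def)
  then have "measure_pmf.expectation (arrivals p T) (\<lambda>\<omega>. loss \<omega> t) \<le>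
      measure_pmf.expectation (arrivals p T) (\<lambda>\<omega>. B * indicator Bad \<omega>)"
    by (intro integral_mono) auto
  also have "\<dots> = B * measure_pmf.prob (arrivals p T) Bad"
    by simp
  also have "\<dots> \<le> B * (6 * real CARD('n) * exp (- 2 * \<eta>\<^sup>2 * m))"
    unfolding Bad_def R
    by (intro mult_left_mono prob_not_typical B(1) s \<eta>(1)) (use m R in auto)
  finally show ?thesis .
qed

end

section \<open>Choice of constants and the bound on the regret\<close>

theorem theorem1:
  fixes A :: "real^'n^'m" and r :: "real^'n" and \<rho> :: "real^'m" and p :: "'n pmf"
    and \<alpha> \<beta> :: real
  assumes "\<And>i j. 0 \<le> A $ i $ j"
    and "\<And>j. 0 \<le> r $ j"
    and "\<And>i. 0 \<le> \<rho> $ i"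
    and "\<And>j. 0 < pmf p j"
    and "0 < \<alpha>" and "\<alpha> < 1"
    and "1 / 2 < \<beta>" and "\<beta> < 1"
  shows "\<exists>C. \<forall>solve. lp_solver A r solve \<longrightarrow>
           (\<forall>T\<ge>1. regret A r \<rho> p T
              (air_policy A \<rho> solve T (learning_times \<alpha> T \<union> allocation_times \<beta> T)) \<le> C)"
proof -
  obtain L where L: "L \<ge> 0"
    "\<And>b b' d d' \<delta> y. 0 \<le> b' \<Longrightarrow> 0 \<le> d' \<Longrightarrow> 0 \<le> \<delta> \<Longrightarrow> (\<And>i. b $ i - b' $ i \<le> \<delta>) \<Longrightarrow>
      (\<And>j. d $ j - d' $ j \<le> \<delta>) \<Longrightarrow> y \<in> lp_feasible A b d \<Longrightarrow>
      \<exists>y'\<in>lp_feasible A b' d'. r \<bullet> y - L * \<delta> \<le> r \<bullet> y'"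
    using lp_value_lipschitz[of A r] assms(1,2) by blast
  obtain \<kappa> where \<kappa>: "\<kappa> \<ge> 0"
    "\<And>b d d' \<delta> u y. 0 \<le> b \<Longrightarrow> 0 \<le> d \<Longrightarrow> (\<And>j. \<bar>d $ j - d' $ j\<bar> \<le> \<delta>) \<Longrightarrow>
      lp_optimal A r b d u \<Longrightarrow> lp_optimal A r b d' y \<Longrightarrow>
      \<exists>z. lp_optimal A r b d' z \<and> (\<forall>j. \<bar>z $ j - u $ j\<bar> \<le> \<kappa> * \<delta>)"
    using lp_optimal_stability[of A r] assms(1,2) by blast
  \<comment> \<open>The inserted 1 accounts for the demand, which drops by one unit per
    period.\<close>
  define M where "M = Max (insert 1 (range (\<lambda>(i, j). A $ i $ j)))"
  have M: "1 \<le> M" "A $ i $ j \<le> M" for i j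
    unfolding M_def by (rule Max_ge; force)+
  define B where "B = L * M"
  have B: "0 \<le> B"
    using L(1) M(1) by (simp add: B_def)
  define \<pi> where "\<pi> = Min (range (pmf p))"
  have \<pi>: "0 < \<pi>" "\<pi> \<le> pmf p j" for j
    using assms(4) by (auto simp: \<pi>_def)
  \<comment> \<open>This spends half of \<open>\<pi> * R\<close> on deviations; the other half
    covers the constant 2 once \<open>R \<ge> 4 / \<pi>\<close>.\<close>
  define \<eta> where "\<eta> = \<pi> / (2 * (4 * \<kappa> + 7))"
  have \<eta>: "0 < \<eta>" "(4 * \<kappa> + 7) * \<eta> = \<pi> / 2"
    using \<pi>(1) \<kappa>(1) by (auto simp: \<eta>_def field_simps)
  \<comment> \<open>Chosen so that \<open>2 * \<eta>\<^sup>2 * m = c * (4 * m)\<close>, which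
    absorbs the quarter in the values of \<open>m\<close>.\<close>
  define c where "c = \<eta>\<^sup>2 / 2"
  have c: "0 < c"
    using \<eta>(1) by (simp add: c_def)
  \<comment> \<open>Positivity of this exponent is equivalent to
    \<open>\<beta> > 1 / 2\<close>.\<close>
  define \<gamma> where "\<gamma> = 2 - 1 / \<beta>"
  have \<gamma>: "0 < \<gamma>"
    using assms(7) by (simp add: \<gamma>_def field_simps)
  define N where "N = 6 * real CARD('n)"
  define R0 where "R0 = max 4 (4 / \<pi>)"
  \<comment> \<open>Summable majorants independent of \<open>T\<close>, one in elapsed and one in
    remaining time. The indicators pay for the first and last few periods, where the concentration
    argument is not applied; \<open>exp c\<close> stems from the \<open>- 1\<close> in
    \<open>t powr \<alpha> - 1\<close>.\<close>
  define h1 where "h1 t = N * exp c * exp (- c * real t powr \<alpha>) + of_bool (t < 3)" for t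
  define h2 where "h2 k = N * exp (- c * real k powr \<gamma>) + of_bool (real k < R0)" for k
  have nonneg: "0 \<le> h1 t" "0 \<le> h2 t" for t
    by (auto simp: h1_def h2_def N_def)
  have summable: "summable h1" "summable h2"
  proof -
    have "summable (\<lambda>t. of_bool (t < 3) :: real)"
      by (rule summable_finite[of "{..<3}"]) auto
    then show "summable h1"
      unfolding h1_def by (intro summable_add summable_mult summable_exp_powr c assms)
    have "real k < R0 \<Longrightarrow> k < nat \<lceil>R0\<rceil>" for k
      by linarith
    then have "summable (\<lambda>k. of_bool (real k < R0) :: real)"
      by (intro summable_finite[of "{..<nat \<lceil>R0\<rceil>}"]) auto
    then show "summable h2"
      unfolding h2_def by (intro summable_add summable_mult summable_exp_powr c \<gamma>)
  qed
  \<comment> \<open>Large horizons meet the conditions of \<open>last_resolve\<close>; for the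
    others the crude bound \<open>B\<close> per period gives \<open>B * T0\<close>.\<close>
  have "eventually (\<lambda>T. real T powr \<beta> \<le> real T / 2 \<and> 6 \<le> T) sequentially"
    using assms(7,8) by (intro eventually_conj eventually_ge_at_top) real_asymp
  then obtain T0 where T0: "\<And>T. T0 \<le> T \<Longrightarrow> real T powr \<beta> \<le> real T / 2 \<and> 6 \<le> T"
    by (auto simp: eventually_sequentially)
  define C where "C = B * T0 + B * (suminf h1 + suminf h2)"
  \<comment> \<open>All constants are fixed before \<open>solve\<close> and \<open>T\<close>, so the
    bound is uniform in both.\<close>
  have "regret A r \<rho> p T (air_policy A \<rho> solve T (learning_times \<alpha> T \<union> allocation_times \<beta> T)) \<le> C"
    if solve: "lp_solver A r solve" and T: "1 \<le> T" for solve T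
  proof -
    define \<T> where "\<T> = learning_times \<alpha> T \<union> allocation_times \<beta> T"
    interpret air A r \<rho> solve T \<T>
      by unfold_locales (use assms solve in auto)
    let ?E = "\<lambda>t. measure_pmf.expectation (arrivals p T) (\<lambda>\<omega>. loss \<omega> t)"
    have loss_B: "loss \<omega> t \<le> B" if "t \<in> {1..T}" for \<omega> t
      unfolding B_def by (rule loss_le[OF L(2) M]) (use that in auto)
    have E_B: "?E t \<le> B" if "t \<in> {1..T}" for t
    proof -
      have "?E t \<le> measure_pmf.expectation (arrivals p T) (\<lambda>\<omega>. B)"
        by (intro integral_mono) (use loss_B that in auto)
      then show ?thesis
        by simp
    qed
    have "(\<Sum>t=1..T. ?E t) \<le> C"
    proof (cases "T0 \<le> T")
      case False
      have "(\<Sum>t=1..T. ?E t) \<le> (\<Sum>t=1..T. B)"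
        by (intro sum_mono E_B)
      also have "\<dots> \<le> B * T0"
        using False B by (simp add: mult.commute mult_left_mono)
      also have "\<dots> \<le> C"
        using B suminf_nonneg[OF summable(1)] suminf_nonneg[OF summable(2)] nonneg by (simp add: C_def)
      finally show ?thesis .
    next
      case True
      have "?E t \<le> B * (h1 t + h2 (T + 1 - t))" if t: "t \<in> {1..T}" for t
      proof (cases "t < 3 \<or> real (T + 1 - t) < R0")
        case True
        then have "1 \<le> h1 t + h2 (T + 1 - t)"
          by (auto simp: h1_def h2_def N_def intro!: add_nonneg_nonneg)
        then have "B * 1 \<le> B * (h1 t + h2 (T + 1 - t))"
          using B by (rule mult_left_mono)
        then show ?thesis
          using E_B[OF t] by simp
      next
        case False
        define R where "R = real T - real t + 1"
        have R: "R = real (T + 1 - t)"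
          using t by (simp add: R_def of_nat_diff)
        have R0: "R0 \<le> R"
          using False R by simp
        obtain s m where s: "s \<in> \<T>" "2 \<le> s" "s \<le> t" "\<T> \<inter> {s<..t} = {}"
          and m: "m \<le> R\<^sup>2 / (real T - real s + 1)"
            "m \<le> R\<^sup>2 * (real s - 1) / (real T - real s + 1)\<^sup>2"
            "m = (real t powr \<alpha> - 1) / 4 \<or> m = R powr \<gamma> / 4"
          by (rule last_resolve[of \<alpha> \<beta> T t R \<T>])
            (use assms T0[OF True] t False R0 in \<open>auto simp: R_def R0_def \<T>_def \<gamma>_def\<close>)
        have "?E t \<le> B * (6 * real CARD('n) * exp (- 2 * \<eta>\<^sup>2 * m))"
        proof (rule expected_loss_le[OF \<kappa>(2,1) B _ s(1-3) _ s(4) R_def m(1,2) \<eta>(1)])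
          show "2 + (4 * \<kappa> + 7) * \<eta> * R \<le> pmf p j * R" for j
          proof -
            have "4 / \<pi> \<le> R"
              using R0 by (simp add: R0_def)
            then have "2 \<le> \<pi> / 2 * R"
              using \<pi>(1) by (simp add: field_simps)
            moreover have "\<pi> * R \<le> pmf p j * R"
              using \<pi>(2) R by (intro mult_right_mono) auto
            ultimately show ?thesis
              unfolding \<eta>(2) by simp
          qed
        qed (use loss_B t in auto)
        also have "\<dots> \<le> B * (h1 t + h2 (T + 1 - t))"
        proof (intro mult_left_mono B)
          have e: "exp (- 2 * \<eta>\<^sup>2 * m) = exp (- c * (4 * m))"
            by (simp add: c_def)
          from m(3) show "6 * real CARD('n) * exp (- 2 * \<eta>\<^sup>2 * m) \<le> h1 t + h2 (T + 1 - t)"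
          proof
            assume "m = (real t powr \<alpha> - 1) / 4"
            then have "4 * m = real t powr \<alpha> - 1"
              by simp
            then have "exp (- 2 * \<eta>\<^sup>2 * m) = exp c * exp (- c * real t powr \<alpha>)"
              unfolding e exp_add[symmetric] by (simp only:) (simp add: algebra_simps)
            then have "6 * real CARD('n) * exp (- 2 * \<eta>\<^sup>2 * m) \<le> h1 t"
              by (simp add: h1_def N_def)
            then show ?thesis
              using nonneg(2)[of "T + 1 - t"] by simp
          next
            assume "m = R powr \<gamma> / 4"
            then have "4 * m = real (T + 1 - t) powr \<gamma>"
              by (simp add: R)
            then have "6 * real CARD('n) * exp (- 2 * \<eta>\<^sup>2 * m) \<le> h2 (T + 1 - t)"
              unfolding e by (simp only:) (simp add: h2_def N_def)
            then show ?thesis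
              using nonneg(1)[of t] by simp
          qed
        qed
        finally show ?thesis .
      qed
      then have "(\<Sum>t=1..T. ?E t) \<le> (\<Sum>t=1..T. B * (h1 t + h2 (T + 1 - t)))"
        by (rule sum_mono)
      also have "\<dots> = B * ((\<Sum>t=1..T. h1 t) + (\<Sum>t=1..T. h2 (T + 1 - t)))"
        by (simp only: sum_distrib_left sum.distrib distrib_left)
      \<comment> \<open>Reversing time turns the sum over remaining periods into a partial sum of
        \<open>h2\<close>.\<close>
      also have "(\<Sum>t=1..T. h2 (T + 1 - t)) = (\<Sum>t=1..T. h2 t)"
        using sum.atLeastAtMost_rev[of h2 1 T] by (simp add: add.commute)
      also have "B * ((\<Sum>t=1..T. h1 t) + (\<Sum>t=1..T. h2 t)) \<le> B * (suminf h1 + suminf h2)"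
        using summable nonneg by (intro mult_left_mono add_mono sum_le_suminf B) auto
      also have "\<dots> \<le> C"
        using B by (simp add: C_def)
      finally show ?thesis .
    qed
    then show ?thesis
      using regret_le_sum_loss[OF T, of p] by (simp add: \<T>_def)
  qed
  then show ?thesis
    by blast
qed

end
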